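(* Let $s>0$, and let $\{e_n\}_{n\ge1}$ be an orthonormal basis of $L^2(\mathbb R)$ that is also an unconditional basis of $H^s(\mathbb R)$. For $N\ge1$ let $\mathsf Q_N$ be the $L^2$-orthogonal projection onto the orthogonal complement of $\mathrm{span}\{e_1,\dots,e_N\}$, and for $A>0$ let $\chi_A$ denote multiplication by the cutoff to $[-A,A]$. Then for every $A>0$ and every $\varepsilon>0$ there exists $N=N(\varepsilon)$ such that $$\|\chi_A\mathsf Q_Nf\|_{L^2(\mathbb R)}\le\varepsilon\|f\|_{H^s(\mathbb R)}\qquad\text{for all }f\in H^s(\mathbb R).$$
   Context: A sequence $\{x_n\}$ in a Banach space $X$ is an unconditional basis if every $x\in X$ has a unique expansion $x=\sum_na_n(x)x_n$ with scalars $a_n(x)$, and this series converges unconditionally. $\|f\|_{H^s}=\|(1+|\xi|^2)^{s/2}\hat f\|_{L^2}$. $\chi_A$ is the indicator function of $[-A,A]$, acting by multiplication; $N$ may depend on $A$ as well. *)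

theory Defs
  imports "HOL-Analysis.Analysis"
begin

text \<open>
  Elements of \<open>L\<^sup>2(\<real>)\<close> and \<open>H\<^sup>s(\<real>)\<close> are represented by Borel measurable functions
  \<open>\<real> \<rightarrow> \<complex>\<close>. Functions that agree almost everywhere are not identified, so the
  norms below are seminorms on representatives, and limits and projections are determined only
  up to null sets.
\<close>

definition L2 :: "(real \<Rightarrow> complex) set" where
  "L2 = {f \<in> borel_measurable lborel. integrable lborel (\<lambda>x. (cmod (f x))\<^sup>2)}"

definition L2_norm :: "(real \<Rightarrow> complex) \<Rightarrow> real" where
  "L2_norm f = sqrt (LINT x|lborel. (cmod (f x))\<^sup>2)"

definition L2_inner :: "(real \<Rightarrow> complex) \<Rightarrow> (real \<Rightarrow> complex) \<Rightarrow> complex" where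
  "L2_inner f g = (LINT x|lborel. f x * cnj (g x))"

definition lin_comb :: "nat \<Rightarrow> (nat \<Rightarrow> complex) \<Rightarrow> (nat \<Rightarrow> real \<Rightarrow> complex) \<Rightarrow> real \<Rightarrow> complex" where
  "lin_comb N a x = (\<lambda>t. \<Sum>n<N. a n * x n t)"

definition span_first :: "nat \<Rightarrow> (nat \<Rightarrow> real \<Rightarrow> complex) \<Rightarrow> (real \<Rightarrow> complex) set" where
  "span_first N x = {lin_comb N a x | a. True}"

text \<open>Orthonormal with dense linear span.\<close>

definition L2_orthonormal_basis :: "(nat \<Rightarrow> real \<Rightarrow> complex) \<Rightarrow> bool" where
  "L2_orthonormal_basis e \<longleftrightarrow>
     (\<forall>n. e n \<in> L2) \<and>
     (\<forall>m n. L2_inner (e m) (e n) = (if m = n then 1 else 0)) \<and>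
     (\<forall>f\<in>L2. \<forall>\<delta>>0. \<exists>N. \<exists>h\<in>span_first N e. L2_norm (\<lambda>t. f t - h t) < \<delta>)"

definition L2_orth_compl :: "(real \<Rightarrow> complex) set \<Rightarrow> (real \<Rightarrow> complex) set" where
  "L2_orth_compl M = {g \<in> L2. \<forall>h\<in>M. L2_inner g h = 0}"

definition L2_orth_proj :: "(real \<Rightarrow> complex) set \<Rightarrow> (real \<Rightarrow> complex) \<Rightarrow> real \<Rightarrow> complex" where
  "L2_orth_proj K f = (SOME g. g \<in> K \<and> (\<lambda>t. f t - g t) \<in> L2_orth_compl K)"

text \<open>
  The sequence is indexed from \<open>0\<close>, so the first \<open>N\<close> elements are \<open>e 0, \<dots>, e (N - 1)\<close>.
\<close>

definition Q_proj :: "(nat \<Rightarrow> real \<Rightarrow> complex) \<Rightarrow> nat \<Rightarrow> (real \<Rightarrow> complex) \<Rightarrow> real \<Rightarrow> complex" where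
  "Q_proj e N = L2_orth_proj (L2_orth_compl (span_first N e))"

definition cutoff :: "real \<Rightarrow> (real \<Rightarrow> complex) \<Rightarrow> real \<Rightarrow> complex" where
  "cutoff A f = (\<lambda>x. indicator {-A..A} x * f x)"

text \<open>
  The Fourier--Plancherel transform on \<open>L\<^sup>2\<close>: \<open>g\<close> is the \<open>L\<^sup>2\<close> limit, as \<open>R \<rightarrow> \<infinity>\<close>, of
  \<open>\<xi> \<mapsto> \<integral>\<^bsub>-R\<^esub>\<^bsup>R\<^esup> f(x) exp(- 2 \<pi> i x \<xi>) dx\<close>. The squared distance is an extended nonnegative
  integral, so that convergence to \<open>0\<close> cannot come from the default value of a divergent
  Bochner integral.
\<close>

definition is_L2_fourier :: "(real \<Rightarrow> complex) \<Rightarrow> (real \<Rightarrow> complex) \<Rightarrow> bool" where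
  "is_L2_fourier f g \<longleftrightarrow> g \<in> L2 \<and>
     ((\<lambda>R. \<integral>\<^sup>+\<xi>. ennreal ((cmod ((LINT x:{-R..R}|lborel. cis (- 2 * pi * x * \<xi>) * f x) - g \<xi>))\<^sup>2)
            \<partial>lborel) \<longlongrightarrow> 0) at_top"

definition L2_fourier :: "(real \<Rightarrow> complex) \<Rightarrow> real \<Rightarrow> complex" where
  "L2_fourier f = (SOME g. is_L2_fourier f g)"

definition sobolev_weighted :: "real \<Rightarrow> (real \<Rightarrow> complex) \<Rightarrow> real \<Rightarrow> complex" where
  "sobolev_weighted s g = (\<lambda>\<xi>. complex_of_real ((1 + \<bar>\<xi>\<bar>\<^sup>2) powr (s / 2)) * g \<xi>)"

text \<open>
  Only meant for \<open>s \<ge> 0\<close>, where \<open>H\<^sup>s\<close> is contained in \<open>L\<^sup>2\<close>.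
\<close>

definition sobolev :: "real \<Rightarrow> (real \<Rightarrow> complex) set" where
  "sobolev s = {f \<in> L2. \<exists>g. is_L2_fourier f g \<and> sobolev_weighted s g \<in> L2}"

definition sobolev_norm :: "real \<Rightarrow> (real \<Rightarrow> complex) \<Rightarrow> real" where
  "sobolev_norm s f = L2_norm (sobolev_weighted s (L2_fourier f))"

text \<open>
  Bases of a function space \<open>X\<close> with (semi)norm \<open>nrm\<close>. Unconditional convergence means that
  every rearrangement of the series converges in \<open>X\<close>.
\<close>

definition series_converges_to ::
    "((real \<Rightarrow> complex) \<Rightarrow> real) \<Rightarrow> (nat \<Rightarrow> complex) \<Rightarrow> (nat \<Rightarrow> real \<Rightarrow> complex) \<Rightarrow>
     (real \<Rightarrow> complex) \<Rightarrow> bool" where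
  "series_converges_to nrm a x f \<longleftrightarrow>
     (\<lambda>N. nrm (\<lambda>t. f t - lin_comb N a x t)) \<longlonglongrightarrow> 0"

definition unconditionally_convergent ::
    "(real \<Rightarrow> complex) set \<Rightarrow> ((real \<Rightarrow> complex) \<Rightarrow> real) \<Rightarrow> (nat \<Rightarrow> complex) \<Rightarrow>
     (nat \<Rightarrow> real \<Rightarrow> complex) \<Rightarrow> bool" where
  "unconditionally_convergent X nrm a x \<longleftrightarrow>
     (\<forall>\<sigma>. bij \<sigma> \<longrightarrow> (\<exists>h\<in>X. series_converges_to nrm (a \<circ> \<sigma>) (x \<circ> \<sigma>) h))"

definition unconditional_basis ::
    "(real \<Rightarrow> complex) set \<Rightarrow> ((real \<Rightarrow> complex) \<Rightarrow> real) \<Rightarrow> (nat \<Rightarrow> real \<Rightarrow> complex) \<Rightarrow> bool" where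
  "unconditional_basis X nrm x \<longleftrightarrow>
     (\<forall>n. x n \<in> X) \<and>
     (\<forall>f\<in>X. (\<exists>!a. series_converges_to nrm a x f) \<and>
            (\<forall>a. series_converges_to nrm a x f \<longrightarrow> unconditionally_convergent X nrm a x))"

end

theory Submission
  imports Defs "HOL-Probability.Probability"
begin

text \<open>
  Let \<open>R\<^sub>N f = f - (\<Sum>n<N. \<langle>f, e\<^sub>n\<rangle> e\<^sub>n)\<close>. Since the \<open>H\<^sup>s\<close> expansion of \<open>f\<close> also converges in \<open>L\<^sup>2\<close>, its
  coefficients are \<open>\<langle>f, e\<^sub>n\<rangle>\<close>, so \<open>R\<^sub>N f\<close> tends to \<open>0\<close> in \<open>H\<^sup>s\<close> for every \<open>f\<close>, and by the uniform boundedness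
  principle the \<open>R\<^sub>N\<close> are uniformly bounded on \<open>H\<^sup>s\<close>. If the theorem failed, normalised remainders would
  give a sequence \<open>g\<^sub>N\<close>, bounded in \<open>H\<^sup>s\<close> and orthogonal to \<open>e\<^sub>0, \<dots>, e\<^bsub>N-1\<^esub>\<close>, whose restrictions to \<open>[-A, A]\<close>
  stay away from \<open>0\<close>. But \<open>g\<^sub>N\<close> is weakly null in \<open>L\<^sup>2\<close>, so its averages over intervals of length \<open>d\<close> tend to
  \<open>0\<close> pointwise and boundedly, while by Plancherel a function bounded in \<open>H\<^sup>s\<close> is uniformly \<open>L\<^sup>2\<close>-close to its
  averages for small \<open>d\<close>.
\<close>

section \<open>The space of square integrable functions\<close>

text \<open>The claim is a form of Rellich's theorem: \<open>cutoff A\<close> is compact from H^s to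
  L2. Compactness enters only as "bounded in H^s and weakly null in L2 implies null in norm", so no
  subsequence is extracted. The delicate point is an H^s bound on the remainders that does not
  depend on N: the e_n are orthogonal in L2 but not in H^s, so Bessel's inequality is of no help
  there. Functions that agree almost everywhere are not identified, so L2 and H^s are sets of
  functions with seminorms. Hence both are instances of one locale, and \<open>Q_proj\<close>, an
  arbitrary choice among representatives, is exchanged for an explicit remainder that is linear at
  every point. Completeness is used only for sequences with steps O(4^-n). The ratio 1/4 leaves room
  for the weight 4^n in the proof that L2 is complete, and in the gliding hump it keeps the later
  steps, of total size 4^-k/3, below the gain 4^-k/2. Of the Fourier transform, only its isometry,
  its closedness under L2 limits and its action on translations are needed; there is no inversion
  formula.\<close>

lemma integrable_nonneg_bound:
  fixes f g :: "'a \<Rightarrow> real"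
  assumes "integrable M f" "g \<in> borel_measurable M" "\<And>x. 0 \<le> g x" "\<And>x. g x \<le> f x"
  shows "integrable M g"
proof (rule Bochner_Integration.integrable_bound[OF assms(1,2)])
  show "AE x in M. norm (g x) \<le> norm (f x)"
    using order_trans[OF assms(3,4)] assms(3,4) by (intro AE_I2) simp
qed

lemma L2_measurable [measurable_dest]: "f \<in> L2 \<Longrightarrow> f \<in> borel_measurable borel"
  by (simp add: L2_def)

lemma L2_integrable: "f \<in> L2 \<Longrightarrow> integrable lborel (\<lambda>x. (cmod (f x))\<^sup>2)"
  by (simp add: L2_def)

lemma L2_norm_nonneg [simp]: "0 \<le> L2_norm f"
  by (simp add: L2_norm_def)

lemma L2_norm_power2: "(L2_norm f)\<^sup>2 = (LINT x|lborel. (cmod (f x))\<^sup>2)"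
  by (simp add: L2_norm_def)

lemma nn_integral_L2: "f \<in> L2 \<Longrightarrow> (\<integral>\<^sup>+x. ennreal ((cmod (f x))\<^sup>2) \<partial>lborel) = ennreal ((L2_norm f)\<^sup>2)"
  by (simp add: L2_norm_power2 nn_integral_eq_integral L2_integrable)

lemma L2I_nn_integral:
  assumes "f \<in> borel_measurable borel" "(\<integral>\<^sup>+x. ennreal ((cmod (f x))\<^sup>2) \<partial>lborel) < \<infinity>"
  shows "f \<in> L2"
  unfolding L2_def using assms by (auto intro!: integrableI_bounded)

lemma L2I_nn_integral_le:
  assumes f: "f \<in> borel_measurable borel"
    and le: "(\<integral>\<^sup>+x. ennreal ((cmod (f x))\<^sup>2) \<partial>lborel) \<le> ennreal (c\<^sup>2)" and c: "0 \<le> c"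
  shows "f \<in> L2" "L2_norm f \<le> c"
proof -
  have "(\<integral>\<^sup>+x. ennreal ((cmod (f x))\<^sup>2) \<partial>lborel) < \<infinity>"
    using le by (metis ennreal_less_top infinity_ennreal_def order_le_less_trans)
  then show 1: "f \<in> L2" using f by (rule L2I_nn_integral[rotated])
  have "(L2_norm f)\<^sup>2 \<le> c\<^sup>2"
    using le nn_integral_L2[OF 1] by simp
  then show "L2_norm f \<le> c" using c by (rule power2_le_imp_le)
qed

lemma L2_bound:
  assumes g: "g \<in> L2" and f: "f \<in> borel_measurable borel"
    and le: "AE x in lborel. cmod (f x) \<le> c * cmod (g x)" and c: "0 \<le> c"
  shows "f \<in> L2" "L2_norm f \<le> c * L2_norm g"
proof -
  have "(\<integral>\<^sup>+x. ennreal ((cmod (f x))\<^sup>2) \<partial>lborel) \<le> (\<integral>\<^sup>+x. ennreal (c\<^sup>2) * ennreal ((cmod (g x))\<^sup>2) \<partial>lborel)"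
  proof (rule nn_integral_mono_AE, use le in eventually_elim)
    case (elim x)
    have "(cmod (f x))\<^sup>2 \<le> (c * cmod (g x))\<^sup>2"
      by (rule power_mono[OF elim]) simp
    then show ?case by (simp add: power_mult_distrib ennreal_mult[symmetric])
  qed
  also have "\<dots> = ennreal ((c * L2_norm g)\<^sup>2)"
    using g by (subst nn_integral_cmult) (auto simp: nn_integral_L2 power_mult_distrib ennreal_mult)
  finally show "f \<in> L2" "L2_norm f \<le> c * L2_norm g"
    using f c by (auto intro: L2I_nn_integral_le)
qed

text \<open>Cauchy-Schwarz with absolute values inside, from the nonnegative quadratic t |-> || t|f|
  - |g| ||^2.\<close>

lemma L2_mult:
  assumes "f \<in> L2" "g \<in> L2" 
  shows L2_integrable_mult: "integrable lborel (\<lambda>x. cmod (f x) * cmod (g x))"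
    and L2_mult_le: "(LINT x|lborel. cmod (f x) * cmod (g x)) \<le> L2_norm f * L2_norm g"
proof -
  note [measurable] = L2_measurable[OF assms(1)] L2_measurable[OF assms(2)]
  have young: "cmod (f x) * cmod (g x) \<le> ((cmod (f x))\<^sup>2 + (cmod (g x))\<^sup>2)" for x
    using sum_squares_bound[of "cmod (f x)" "cmod (g x)"]
      mult_nonneg_nonneg[OF norm_ge_zero[of "f x"] norm_ge_zero[of "g x"]] by linarith
  show int: "integrable lborel (\<lambda>x. cmod (f x) * cmod (g x))"
    by (rule integrable_nonneg_bound[of _ "\<lambda>x. (cmod (f x))\<^sup>2 + (cmod (g x))\<^sup>2"])
       (use assms young in \<open>simp_all add: L2_integrable\<close>)
  let ?I = "LINT x|lborel. cmod (f x) * cmod (g x)"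
  have I0: "0 \<le> ?I" by simp
  have quad: "0 \<le> (L2_norm f)\<^sup>2 * t\<^sup>2 - 2 * t * ?I + (L2_norm g)\<^sup>2" for t
  proof -
    have "0 \<le> (LINT x|lborel. (t * cmod (f x) - cmod (g x))\<^sup>2)" by simp
    also have "\<dots> = (LINT x|lborel. t\<^sup>2 * (cmod (f x))\<^sup>2 - (2 * t) * (cmod (f x) * cmod (g x)) + (cmod (g x))\<^sup>2)"
      by (simp add: power2_diff power_mult_distrib algebra_simps)
    also have "\<dots> = (L2_norm f)\<^sup>2 * t\<^sup>2 - 2 * t * ?I + (L2_norm g)\<^sup>2"
      using assms int by (simp add: L2_integrable L2_norm_power2)
    finally show ?thesis .
  qed
  have "?I\<^sup>2 \<le> (L2_norm f * L2_norm g)\<^sup>2"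
  proof (cases "L2_norm f = 0")
    case True
    \<comment> \<open>The quadratic is affine in t here; at t = (||g||^2 + 1)/I it would be
      negative.\<close>
    have "?I = 0"
    proof (rule ccontr)
      assume "?I \<noteq> 0"
      then have "2 * (((L2_norm g)\<^sup>2 + 1) / ?I) * ?I = 2 * ((L2_norm g)\<^sup>2 + 1)" by simp
      then show False
        using quad[of "((L2_norm g)\<^sup>2 + 1) / ?I"] True zero_le_power2[of "L2_norm g"] by simp
    qed
    then show ?thesis by simp
  next
    case False
    \<comment> \<open>The minimiser of the quadratic.\<close>
    define t where "t = ?I / (L2_norm f)\<^sup>2"
    have "(L2_norm f)\<^sup>2 * t\<^sup>2 = t * ?I" "t * ?I * (L2_norm f)\<^sup>2 = ?I\<^sup>2"
      using False by (simp_all add: t_def power2_eq_square)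
    then have "t * ?I \<le> (L2_norm g)\<^sup>2" using quad[of t] by simp
    then have "t * ?I * (L2_norm f)\<^sup>2 \<le> (L2_norm g)\<^sup>2 * (L2_norm f)\<^sup>2"
      by (rule mult_right_mono) simp
    then show ?thesis
      using \<open>t * ?I * (L2_norm f)\<^sup>2 = ?I\<^sup>2\<close> by (simp add: power_mult_distrib mult.commute)
  qed
  then show "?I \<le> L2_norm f * L2_norm g"
    by (rule power2_le_imp_le) simp
qed

lemma borel_measurable_cnj [measurable (raw)]:
  "f \<in> borel_measurable M \<Longrightarrow> (\<lambda>x. cnj (f x)) \<in> borel_measurable M"
  by (rule borel_measurable_continuous_on) (intro continuous_intros)

lemma L2_inner_integrable:
  assumes "f \<in> L2" "g \<in> L2"
  shows "integrable lborel (\<lambda>x. f x * cnj (g x))"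
proof -
  note [measurable] = L2_measurable[OF assms(1)] L2_measurable[OF assms(2)]
  show ?thesis
    by (rule Bochner_Integration.integrable_bound[OF L2_integrable_mult[OF assms]]) (auto simp: norm_mult)
qed

lemma L2_inner_bound:
  assumes "f \<in> L2" "g \<in> L2"
  shows "cmod (L2_inner f g) \<le> L2_norm f * L2_norm g"
proof -
  have "cmod (L2_inner f g) \<le> (LINT x|lborel. cmod (f x * cnj (g x)))"
    unfolding L2_inner_def by (rule integral_norm_bound)
  also have "\<dots> \<le> L2_norm f * L2_norm g"
    using L2_mult_le[OF assms] by (simp add: norm_mult)
  finally show ?thesis .
qed

lemma L2_add [intro]:
  assumes "f \<in> L2" "g \<in> L2" shows "(\<lambda>x. f x + g x) \<in> L2"
proof -
  note [measurable] = L2_measurable[OF assms(1)] L2_measurable[OF assms(2)]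
  have le: "(cmod (f x + g x))\<^sup>2 \<le> 2 * ((cmod (f x))\<^sup>2 + (cmod (g x))\<^sup>2)" for x
  proof -
    have "(cmod (f x + g x))\<^sup>2 \<le> (cmod (f x) + cmod (g x))\<^sup>2"
      by (intro power_mono norm_triangle_ineq) simp
    also have "\<dots> \<le> 2 * ((cmod (f x))\<^sup>2 + (cmod (g x))\<^sup>2)"
      using sum_squares_bound[of "cmod (f x)" "cmod (g x)"] by (simp add: power2_sum)
    finally show ?thesis .
  qed
  have "integrable lborel (\<lambda>x. (cmod (f x + g x))\<^sup>2)"
    by (rule integrable_nonneg_bound[of _ "\<lambda>x. 2 * ((cmod (f x))\<^sup>2 + (cmod (g x))\<^sup>2)"])
       (use assms le in \<open>simp_all add: L2_integrable\<close>)
  then show ?thesis by (simp add: L2_def)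
qed

lemma L2_scale [intro]: "f \<in> L2 \<Longrightarrow> (\<lambda>x. c * f x) \<in> L2"
  by (rule L2_bound(1)[where c="cmod c"]) (auto simp: norm_mult L2_measurable)

lemma L2_diff [intro]:
  assumes "f \<in> L2" "g \<in> L2" shows "(\<lambda>x. f x - g x) \<in> L2"
  using L2_add[OF assms(1) L2_scale[OF assms(2), of "-1"]] by simp

lemma L2_zero [intro]: "(\<lambda>x. 0) \<in> L2"
  by (simp add: L2_def)

lemma L2_sum [intro]: "(\<And>i. i \<in> I \<Longrightarrow> f i \<in> L2) \<Longrightarrow> (\<lambda>x. \<Sum>i\<in>I. f i x) \<in> L2"
  by (induction I rule: infinite_finite_induct) auto

lemma L2_norm_zero [simp]: "L2_norm (\<lambda>x. 0) = 0"
  by (simp add: L2_norm_def)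

lemma L2_norm_scale: "L2_norm (\<lambda>x. c * f x) = cmod c * L2_norm f"
  unfolding L2_norm_def norm_mult power_mult_distrib by (simp add: real_sqrt_mult)

lemma L2_norm_minus_commute: "L2_norm (\<lambda>x. f x - g x) = L2_norm (\<lambda>x. g x - f x)"
  by (simp add: L2_norm_def norm_minus_commute)

lemma L2_norm_cong_AE:
  assumes "AE x in lborel. cmod (f x) = cmod (g x)" "f \<in> borel_measurable borel" "g \<in> borel_measurable borel"
  shows "L2_norm f = L2_norm g"
proof -
  have "(LINT x|lborel. (cmod (f x))\<^sup>2) = (LINT x|lborel. (cmod (g x))\<^sup>2)"
    by (rule integral_cong_AE) (use assms in auto)
  then show ?thesis by (simp add: L2_norm_def)
qed

lemma L2_norm_eq_0_iff_AE:
  assumes "f \<in> L2" shows "L2_norm f = 0 \<longleftrightarrow> (AE x in lborel. f x = 0)"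
  using integral_nonneg_eq_0_iff_AE[OF L2_integrable[OF assms]] by (simp add: L2_norm_def)

lemma L2_norm_triangle:
  assumes "f \<in> L2" "g \<in> L2"
  shows "L2_norm (\<lambda>x. f x + g x) \<le> L2_norm f + L2_norm g"
proof -
  note int = L2_integrable[OF assms(1)] L2_integrable[OF assms(2)] L2_integrable_mult[OF assms] 
  have "(L2_norm (\<lambda>x. f x + g x))\<^sup>2 \<le> (LINT x|lborel. (cmod (f x))\<^sup>2 + 2 * (cmod (f x) * cmod (g x)) + (cmod (g x))\<^sup>2)"
    unfolding L2_norm_power2
  proof (rule integral_mono)
    show "integrable lborel (\<lambda>x. (cmod (f x + g x))\<^sup>2)" using assms by (intro L2_integrable L2_add)
    show "(cmod (f x + g x))\<^sup>2 \<le> (cmod (f x))\<^sup>2 + 2 * (cmod (f x) * cmod (g x)) + (cmod (g x))\<^sup>2" for x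
    proof -
      have "(cmod (f x + g x))\<^sup>2 \<le> (cmod (f x) + cmod (g x))\<^sup>2"
        by (intro power_mono norm_triangle_ineq) simp
      then show ?thesis by (simp add: power2_sum)
    qed
  qed (use int in auto)
  also have "\<dots> = (L2_norm f)\<^sup>2 + 2 * (LINT x|lborel. cmod (f x) * cmod (g x)) + (L2_norm g)\<^sup>2"
    using int by (simp add: L2_norm_power2)
  also have "\<dots> \<le> (L2_norm f + L2_norm g)\<^sup>2"
    using L2_mult_le[OF assms] by (simp add: power2_sum)
  finally show ?thesis by (rule power2_le_imp_le) simp
qed

lemma L2_norm_diff_triangle:
  assumes "f \<in> L2" "g \<in> L2" "h \<in> L2"
  shows "L2_norm (\<lambda>x. f x - h x) \<le> L2_norm (\<lambda>x. f x - g x) + L2_norm (\<lambda>x. g x - h x)"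
  using L2_norm_triangle[OF L2_diff[OF assms(1,2)] L2_diff[OF assms(2,3)]] by simp

lemma L2_norm_diff_ge:
  assumes "f \<in> L2" "g \<in> L2"
  shows "\<bar>L2_norm f - L2_norm g\<bar> \<le> L2_norm (\<lambda>x. f x - g x)"
  using L2_norm_triangle[OF L2_diff[OF assms] assms(2)]
    L2_norm_triangle[OF L2_diff[OF assms(2,1)] assms(1)] L2_norm_minus_commute[of f g]
  by simp

lemma L2_norm_diff_le:
  assumes "f \<in> L2" "g \<in> L2"
  shows "L2_norm (\<lambda>x. f x - g x) \<le> L2_norm f + L2_norm g"
  using L2_norm_triangle[OF assms(1) L2_scale[OF assms(2), of "-1"]] L2_norm_scale[of "-1" g] by simp

lemma L2_inner_self: "L2_inner f f = complex_of_real ((L2_norm f)\<^sup>2)"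
  unfolding L2_inner_def L2_norm_power2 integral_complex_of_real[symmetric]
  by (simp only: complex_norm_square)

lemma L2_inner_add_left:
  "f \<in> L2 \<Longrightarrow> g \<in> L2 \<Longrightarrow> h \<in> L2 \<Longrightarrow> L2_inner (\<lambda>x. f x + g x) h = L2_inner f h + L2_inner g h"
  by (simp add: L2_inner_def ring_distribs L2_inner_integrable)

lemma L2_inner_diff_left:
  "f \<in> L2 \<Longrightarrow> g \<in> L2 \<Longrightarrow> h \<in> L2 \<Longrightarrow> L2_inner (\<lambda>x. f x - g x) h = L2_inner f h - L2_inner g h"
  by (simp add: L2_inner_def ring_distribs L2_inner_integrable)

lemma L2_inner_scale_left: "L2_inner (\<lambda>x. c * f x) h = c * L2_inner f h"
  by (simp add: L2_inner_def mult.assoc)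

lemma L2_inner_commute: "L2_inner f g = cnj (L2_inner g f)"
proof -
  have "L2_inner f g = (LINT x|lborel. cnj (g x * cnj (f x)))"
    by (simp add: L2_inner_def mult.commute del: Bochner_Integration.integral_cnj)
  also have "\<dots> = cnj (L2_inner g f)"
    unfolding L2_inner_def by (rule Bochner_Integration.integral_cnj)
  finally show ?thesis .
qed

lemma L2_inner_diff_right:
  "f \<in> L2 \<Longrightarrow> g \<in> L2 \<Longrightarrow> h \<in> L2 \<Longrightarrow> L2_inner h (\<lambda>x. f x - g x) = L2_inner h f - L2_inner h g"
  using L2_inner_diff_left[of f g h] by (simp add: L2_inner_commute[of h])

lemma L2_inner_sum_left:
  "(\<And>i. i \<in> I \<Longrightarrow> f i \<in> L2) \<Longrightarrow> h \<in> L2 \<Longrightarrow> L2_inner (\<lambda>x. \<Sum>i\<in>I. f i x) h = (\<Sum>i\<in>I. L2_inner (f i) h)"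
proof (induction I rule: infinite_finite_induct)
  case (insert i I)
  then show ?case by (simp add: L2_inner_add_left L2_sum)
qed (auto simp: L2_inner_def)

lemma L2_dominated_convergence:
  assumes f: "\<And>n. f n \<in> borel_measurable borel" and g: "g \<in> borel_measurable borel"
    and w: "integrable lborel (\<lambda>x. (w x)\<^sup>2)"
    and bd: "\<And>n. AE x in lborel. cmod (f n x - g x) \<le> w x"
    and lim: "AE x in lborel. (\<lambda>n. f n x) \<longlonglongrightarrow> g x"
  shows "(\<lambda>n. L2_norm (\<lambda>x. f n x - g x)) \<longlonglongrightarrow> 0"
proof -
  note [measurable] = f g
  have "(\<lambda>n. LINT x|lborel. (cmod (f n x - g x))\<^sup>2) \<longlonglongrightarrow> (LINT x|(lborel::real measure). (0::real))"
  proof (rule integral_dominated_convergence[where f="\<lambda>x. 0" and w="\<lambda>x. (w x)\<^sup>2"])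
    show "AE x in lborel. (\<lambda>n. (cmod (f n x - g x))\<^sup>2) \<longlonglongrightarrow> 0"
      using lim by eventually_elim (auto intro!: tendsto_eq_intros simp: LIM_zero_iff)
    show "AE x in lborel. norm ((cmod (f n x - g x))\<^sup>2) \<le> (w x)\<^sup>2" for n
      using bd[of n] by eventually_elim (auto intro!: power_mono)
  qed (use w in auto)
  then show ?thesis unfolding L2_norm_def using tendsto_real_sqrt by fastforce
qed

section \<open>Seminorms on spaces of functions, and completeness of L2\<close>

text \<open>The common frame for L2 and all Sobolev spaces. Definiteness is not assumed, since a
  nonzero function that vanishes almost everywhere has norm 0.\<close>

locale function_seminorm =
  fixes X :: "('a \<Rightarrow> complex) set" and p :: "('a \<Rightarrow> complex) \<Rightarrow> real"
  assumes zero_mem: "(\<lambda>x. 0) \<in> X"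
    and add_mem: "f \<in> X \<Longrightarrow> g \<in> X \<Longrightarrow> (\<lambda>x. f x + g x) \<in> X"
    and scale_mem: "f \<in> X \<Longrightarrow> (\<lambda>x. c * f x) \<in> X"
    and triangle: "f \<in> X \<Longrightarrow> g \<in> X \<Longrightarrow> p (\<lambda>x. f x + g x) \<le> p f + p g"
    and scale: "f \<in> X \<Longrightarrow> p (\<lambda>x. c * f x) = cmod c * p f"
begin

lemma diff_mem: "f \<in> X \<Longrightarrow> g \<in> X \<Longrightarrow> (\<lambda>x. f x - g x) \<in> X"
  using add_mem[of f "\<lambda>x. -1 * g x"] scale_mem[of g "-1"] by simp

lemma sum_mem: "(\<And>i. i \<in> I \<Longrightarrow> f i \<in> X) \<Longrightarrow> (\<lambda>x. \<Sum>i\<in>I. f i x) \<in> X"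
  by (induction I rule: infinite_finite_induct) (auto simp: zero_mem add_mem)

lemma p_zero: "p (\<lambda>x. 0) = 0"
  using scale[OF zero_mem, of 0] by simp

lemma minus_commute: "f \<in> X \<Longrightarrow> g \<in> X \<Longrightarrow> p (\<lambda>x. f x - g x) = p (\<lambda>x. g x - f x)"
  using scale[OF diff_mem, of f g "-1"] by simp

lemma nonneg: "f \<in> X \<Longrightarrow> 0 \<le> p f"
  using triangle[OF _ scale_mem, of f f "-1"] scale[of f "-1"] p_zero by simp

lemma diff_triangle:
  "f \<in> X \<Longrightarrow> g \<in> X \<Longrightarrow> h \<in> X \<Longrightarrow> p (\<lambda>x. f x - h x) \<le> p (\<lambda>x. f x - g x) + p (\<lambda>x. g x - h x)"
  using triangle[OF diff_mem diff_mem, of f g g h] by simp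

lemma sum_le: "(\<And>i. i \<in> I \<Longrightarrow> f i \<in> X) \<Longrightarrow> p (\<lambda>x. \<Sum>i\<in>I. f i x) \<le> (\<Sum>i\<in>I. p (f i))"
proof (induction I rule: infinite_finite_induct)
  case (insert i I)
  then show ?case
    using triangle[of "f i" "\<lambda>x. \<Sum>i\<in>I. f i x"] sum_mem[of I f] by simp
qed (auto simp: p_zero)

lemma geometric_dist:
  assumes "\<And>n. f n \<in> X" and step: "\<And>n. p (\<lambda>x. f (Suc n) x - f n x) \<le> c * (1/4) ^ n"
  shows "p (\<lambda>x. f (n + k) x - f n x) \<le> c * (1/4) ^ n * (4/3)"
proof -
  \<comment> \<open>The exact geometric sum 1 + 1/4 + ... + 4^-(k-1) = (4/3)(1 - 4^-k) is kept so
    that the induction closes.\<close>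
  have "p (\<lambda>x. f (n + k) x - f n x) \<le> c * (1/4) ^ n * (4/3) * (1 - (1/4) ^ k)"
  proof (induction k)
    case 0 then show ?case by (simp add: p_zero)
  next
    case (Suc k)
    have "p (\<lambda>x. f (n + Suc k) x - f n x) \<le> p (\<lambda>x. f (Suc (n + k)) x - f (n + k) x) + p (\<lambda>x. f (n + k) x - f n x)"
      using diff_triangle[of "f (Suc (n + k))" "f (n + k)" "f n"] assms(1) by simp
    also have "\<dots> \<le> c * (1/4) ^ (n + k) + c * (1/4) ^ n * (4/3) * (1 - (1/4) ^ k)"
      by (intro add_mono step Suc.IH)
    also have "\<dots> = c * (1/4) ^ n * (4/3) * (1 - (1/4) ^ Suc k)"
      by (simp add: power_add field_simps)
    finally show ?case .
  qed
  also have "\<dots> \<le> c * (1/4) ^ n * (4/3) * 1"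
  proof (rule mult_left_mono)
    show "0 \<le> c * (1/4) ^ n * (4/3)"
      using order_trans[OF nonneg[OF diff_mem] step[of n]] assms(1) by simp
  qed simp
  finally show ?thesis by simp
qed

end

interpretation L2: function_seminorm L2 L2_norm
  by unfold_locales (auto simp: L2_norm_triangle L2_norm_scale)

text \<open>Riesz-Fischer. The increments have squared norm at most c^2/16^n, so the sum of 4^n |d
  n|^2 still has finite integral; it is therefore finite almost everywhere, which forces |d n x| =
  O(2^-n) and pointwise convergence.\<close>

lemma L2_complete:
  assumes f: "\<And>n. f n \<in> L2" and step: "\<And>n. L2_norm (\<lambda>x. f (Suc n) x - f n x) \<le> c * (1/4) ^ n"
  shows "\<exists>g\<in>L2. (\<lambda>n. L2_norm (\<lambda>x. f n x - g x)) \<longlonglongrightarrow> 0"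
proof -
  have c0: "0 \<le> c" using order_trans[OF L2_norm_nonneg step[of 0]] by simp
  note [measurable] = L2_measurable[OF f]
  define d where "d n x = f (Suc n) x - f n x" for n x
  have d: "d n \<in> L2" for n unfolding d_def by (intro L2_diff f)
  note [measurable] = L2_measurable[OF d]
  have "(\<integral>\<^sup>+x. (\<Sum>n. ennreal (4 ^ n * (cmod (d n x))\<^sup>2)) \<partial>lborel) 
      = (\<Sum>n. \<integral>\<^sup>+x. ennreal (4 ^ n * (cmod (d n x))\<^sup>2) \<partial>lborel)"
    by (rule nn_integral_suminf) measurable
  also have "\<dots> = (\<Sum>n. ennreal (4 ^ n * (L2_norm (d n))\<^sup>2))"
    by (simp add: ennreal_mult nn_integral_cmult nn_integral_L2[OF d])
  also have "\<dots> \<le> (\<Sum>n. ennreal (c\<^sup>2 * (1/4) ^ n))"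
  proof (intro suminf_le ennreal_leI)
    fix n
    have "4 ^ n * (L2_norm (d n))\<^sup>2 \<le> 4 ^ n * (c * (1/4) ^ n)\<^sup>2"
      using step[of n] by (intro mult_left_mono power_mono) (auto simp: d_def[abs_def])
    also have "\<dots> = c\<^sup>2 * (1/4) ^ n"
      by (simp add: power_mult_distrib power2_eq_square power_divide)
    finally show "4 ^ n * (L2_norm (d n))\<^sup>2 \<le> c\<^sup>2 * (1/4) ^ n" .
  qed auto
  also have "\<dots> < \<infinity>"
  proof -
    have "summable (\<lambda>n. c\<^sup>2 * (1/4::real) ^ n)" by (intro summable_mult summable_geometric) simp
    then show ?thesis by (subst suminf_ennreal2) auto
  qed
  finally have "AE x in lborel. (\<Sum>n. ennreal (4 ^ n * (cmod (d n x))\<^sup>2)) \<noteq> \<infinity>"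
    by (intro nn_integral_PInf_AE) auto
  then have conv: "AE x in lborel. convergent (\<lambda>n. f n x)"
  proof eventually_elim
    case (elim x)
    then have sm: "summable (\<lambda>n. 4 ^ n * (cmod (d n x))\<^sup>2)"
      by (intro summable_suminf_not_top) auto
    then obtain B where B: "\<And>n. 4 ^ n * (cmod (d n x))\<^sup>2 \<le> B"
      using summable_imp_Bseq[OF sm] unfolding Bseq_def by (auto simp: abs_mult)
    have dn: "norm (d n x) \<le> sqrt B * (1/2) ^ n" for n
    proof -
      have "(2 ^ n * cmod (d n x))\<^sup>2 \<le> B"
        using B[of n] by (simp add: power_mult_distrib power_mult[symmetric] mult.commute[of n] power_mult[of 2 2])
      then have "2 ^ n * cmod (d n x) \<le> sqrt B" by (rule real_le_rsqrt)
      then show ?thesis by (simp add: field_simps power_divide)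
    qed
    have "summable (\<lambda>n. d n x)"
      by (rule summable_comparison_test'[OF summable_mult[OF summable_geometric] dn]) simp
    then have "convergent (\<lambda>n. \<Sum>k<n. d k x)" by (simp add: summable_iff_convergent)
    then have "convergent (\<lambda>n. f 0 x + (\<Sum>k<n. d k x))" by (intro convergent_add convergent_const)
    moreover have "f 0 x + (\<Sum>k<n. d k x) = f n x" for n
      using sum_lessThan_telescope[of "\<lambda>k. f k x" n] by (simp add: d_def)
    ultimately show ?case by simp
  qed
  \<comment> \<open>On the null set without convergence \<open>lim\<close> takes some default value;
    \<open>g\<close> is measurable all the same.\<close>
  define g where "g x = lim (\<lambda>n. f n x)" for x
  have g[measurable]: "g \<in> borel_measurable borel" unfolding g_def by measurable
  \<comment> \<open>Fatou's lemma in k carries the geometric bound on f n - f (n + k) over to f n -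
    g.\<close>
  have dist: "(\<lambda>x. f n x - g x) \<in> L2" "L2_norm (\<lambda>x. f n x - g x) \<le> c * (1/4) ^ n * (4/3)" for n
  proof -
    have "(\<integral>\<^sup>+x. ennreal ((cmod (f n x - g x))\<^sup>2) \<partial>lborel) 
      = (\<integral>\<^sup>+x. liminf (\<lambda>k. ennreal ((cmod (f n x - f (n + k) x))\<^sup>2)) \<partial>lborel)"
    proof (rule nn_integral_cong_AE, use conv in eventually_elim)
      case (elim x)
      then have "(\<lambda>k. f k x) \<longlonglongrightarrow> g x" by (simp add: g_def convergent_LIMSEQ_iff)
      then have "(\<lambda>k. f (n + k) x) \<longlonglongrightarrow> g x" using LIMSEQ_ignore_initial_segment[of _ _ n] by (simp add: add.commute)
      then have "(\<lambda>k. ennreal ((cmod (f n x - f (n + k) x))\<^sup>2)) \<longlonglongrightarrow> ennreal ((cmod (f n x - g x))\<^sup>2)"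
        by (intro tendsto_intros tendsto_ennrealI)
      then show ?case by (intro lim_imp_Liminf[symmetric]) simp_all
    qed
    also have "\<dots> \<le> liminf (\<lambda>k. \<integral>\<^sup>+x. ennreal ((cmod (f n x - f (n + k) x))\<^sup>2) \<partial>lborel)"
      by (rule nn_integral_liminf) measurable
    also have "\<dots> \<le> liminf (\<lambda>k. ennreal ((c * (1/4) ^ n * (4/3))\<^sup>2))"
    proof (rule Liminf_mono, rule always_eventually, rule allI)
      fix k
      have "L2_norm (\<lambda>x. f n x - f (n + k) x) \<le> c * (1/4) ^ n * (4/3)"
        using L2.geometric_dist[OF f step, of n k] by (simp add: L2_norm_minus_commute)
      then show "(\<integral>\<^sup>+x. ennreal ((cmod (f n x - f (n + k) x))\<^sup>2) \<partial>lborel) \<le> ennreal ((c * (1/4) ^ n * (4/3))\<^sup>2)"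
        by (subst nn_integral_L2) (auto intro!: ennreal_leI power_mono L2_diff f)
    qed
    also have "\<dots> = ennreal ((c * (1/4) ^ n * (4/3))\<^sup>2)" by (simp add: Liminf_const)
    finally have le: "(\<integral>\<^sup>+x. ennreal ((cmod (f n x - g x))\<^sup>2) \<partial>lborel) \<le> ennreal ((c * (1/4) ^ n * (4/3))\<^sup>2)" .
    show "(\<lambda>x. f n x - g x) \<in> L2" "L2_norm (\<lambda>x. f n x - g x) \<le> c * (1/4) ^ n * (4/3)"
      by (rule L2I_nn_integral_le[OF _ le]; use c0 in simp)+
  qed
  have "g \<in> L2" using L2_diff[OF f dist(1), of 0 0] by simp
  moreover have "(\<lambda>n. L2_norm (\<lambda>x. f n x - g x)) \<longlonglongrightarrow> 0"
  proof (rule tendsto_sandwich[where f="\<lambda>_. 0" and h="\<lambda>n. c * (1/4) ^ n * (4/3)"])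
    show "(\<lambda>n. c * (1/4) ^ n * (4/3)) \<longlonglongrightarrow> 0"
      by (auto intro!: tendsto_eq_intros LIMSEQ_realpow_zero)
  qed (use dist in auto)
  ultimately show ?thesis by blast
qed

lemma L2_bounded_support:
  assumes "f \<in> borel_measurable borel" "\<And>x. cmod (f x) \<le> B" "\<And>x. x \<notin> {a..b} \<Longrightarrow> f x = 0"
  shows "f \<in> L2"
proof -
  have "integrable lborel (\<lambda>x. B\<^sup>2 * indicator {a..b} x)"
    by (intro integrable_mult_right integrable_real_indicator) (auto simp: emeasure_lborel_Icc_eq)
  then have "integrable lborel (\<lambda>x. (cmod (f x))\<^sup>2)"
  proof (rule integrable_nonneg_bound)
    show "(cmod (f x))\<^sup>2 \<le> B\<^sup>2 * indicator {a..b} x" for x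
      using assms(2)[of x] assms(3)[of x] by (auto split: split_indicator intro: power_mono)
  qed (use assms in auto)
  then show ?thesis using assms by (simp add: L2_def)
qed

section \<open>Approximation by continuous functions and continuity of translations\<close>

text \<open>The predicate \<open>measurable_on\<close> of gauge integration is defined by
  approximation with continuous functions off a negligible set, and Lebesgue measurable functions
  satisfy it.\<close>

lemma borel_measurable_imp_AE_continuous_limit:
  fixes f :: "real \<Rightarrow> complex"
  assumes "f \<in> borel_measurable borel"
  obtains g where "\<And>n. continuous_on UNIV (g n)" "AE x in lborel. (\<lambda>n. g n x) \<longlonglongrightarrow> f x"
proof -
  have "f \<in> borel_measurable lebesgue" using assms by (simp add: measurable_completion)
  then have "f measurable_on UNIV" by (simp add: lebesgue_measurable_imp_measurable_on)
  then obtain N g where N: "negligible N" and g: "\<And>n. continuous_on UNIV (g n)"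
    and lim: "\<And>x. x \<notin> N \<Longrightarrow> (\<lambda>n. g n x) \<longlonglongrightarrow> f x"
    unfolding measurable_on_def by auto
  have "AE x in lebesgue. x \<notin> N" using N by (simp add: negligible_iff_null_sets AE_not_in)
  then have "AE x in lborel. x \<notin> N" by (simp add: AE_completion_iff)
  then have "AE x in lborel. (\<lambda>n. g n x) \<longlonglongrightarrow> f x"
    by eventually_elim (rule lim)
  with g show ?thesis by (rule that)
qed

lemma power2_mult_indicator: "(c * indicator A x :: real)\<^sup>2 = c\<^sup>2 * indicator A x"
  by (simp split: split_indicator)

text \<open>First f is truncated both in space and in size, giving \<open>F k\<close> close to f.
  With k fixed, f inside the truncation is then replaced by continuous functions converging to it
  almost everywhere. The truncation gives a common bound and a common compact support, so this
  convergence also holds in L2.\<close>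

lemma L2_dense_continuous:
  assumes f: "f \<in> L2" and e: "0 < \<epsilon>"
  obtains \<phi> R where "continuous_on UNIV \<phi>" "\<And>x. x \<notin> {-R..R} \<Longrightarrow> \<phi> x = 0" "\<phi> \<in> L2"
    "L2_norm (\<lambda>x. f x - \<phi> x) < \<epsilon>"
proof -
  note [measurable] = L2_measurable[OF f]
  \<comment> \<open>Trapezoid: 1 on [-k, k], 0 outside [-(k+1), k+1].\<close>
  define \<eta> where "\<eta> k x = max 0 (min 1 (real k + 1 - \<bar>x\<bar>))" for k :: nat and x :: real
  \<comment> \<open>The radial retraction onto the closed disc of radius k + 1.\<close>
  define c where "c k z = z /\<^sub>R max 1 (cmod z / (real k + 1))" for k :: nat and z :: complex
  have \<eta>01: "0 \<le> \<eta> k x" "\<eta> k x \<le> 1" for k x by (auto simp: \<eta>_def)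
  have c_cont: "continuous_on UNIV (c k)" for k
    unfolding c_def by (intro continuous_intros) (auto simp: max_def)
  have c_le: "cmod (c k z) \<le> cmod z" for k z
    by (auto simp: c_def divide_simps mult_le_cancel_left1)
  have c_bd: "cmod (c k z) \<le> real k + 1" for k z
  proof (cases "cmod z \<le> real k + 1")
    case True then show ?thesis using c_le order_trans by blast
  next
    case False
    then have "max 1 (cmod z / (real k + 1)) = cmod z / (real k + 1)" by (simp add: max_def field_simps)
    moreover have "z \<noteq> 0" using False by auto
    ultimately show ?thesis by (simp add: c_def)
  qed
  have \<eta>_cont: "continuous_on UNIV (\<eta> k)" for k
    unfolding \<eta>_def by (intro continuous_intros)
  note [measurable] = borel_measurable_continuous_onI[OF \<eta>_cont] borel_measurable_continuous_onI[OF c_cont]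
  define F where "F k x = complex_of_real (\<eta> k x) * c k (f x)" for k x
  have Fm[measurable]: "F k \<in> borel_measurable borel" for k
    unfolding F_def by measurable
  have "(\<lambda>k. L2_norm (\<lambda>x. F k x - f x)) \<longlonglongrightarrow> 0"
  proof (rule L2_dominated_convergence[where w="\<lambda>x. 2 * cmod (f x)"])
    show "integrable lborel (\<lambda>x. (2 * cmod (f x))\<^sup>2)"
      using L2_integrable[OF f] by (simp add: power_mult_distrib)
    have "cmod (F k x - f x) \<le> 2 * cmod (f x)" for k x
    proof -
      have "cmod (F k x) \<le> 1 * cmod (f x)"
        unfolding F_def norm_mult using \<eta>01[of k x] c_le[of k "f x"] by (intro mult_mono) auto
      then show ?thesis using norm_triangle_ineq4[of "F k x" "f x"] by simp
    qed
    then show "AE x in lborel. cmod (F k x - f x) \<le> 2 * cmod (f x)" for k by simp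
    have "(\<lambda>k. F k x) \<longlonglongrightarrow> f x" for x
    proof (rule tendsto_eventually)
      obtain K :: nat where K: "\<bar>x\<bar> + cmod (f x) < real K" using reals_Archimedean2 by blast
      have "F k x = f x" if "K \<le> k" for k
      proof -
        have "\<bar>x\<bar> + cmod (f x) < real k" using K that by linarith
        then have "\<bar>x\<bar> \<le> real k" "cmod (f x) \<le> real k + 1"
          using norm_ge_zero[of "f x"] by linarith+
        then have "\<bar>x\<bar> \<le> real k" "cmod (f x) / (real k + 1) \<le> 1"
          by (simp_all add: field_simps)
        then show ?thesis by (simp add: F_def \<eta>_def c_def max_def)
      qed
      then show "eventually (\<lambda>k. F k x = f x) sequentially" by (auto simp: eventually_sequentially)
    qed
    then show "AE x in lborel. (\<lambda>k. F k x) \<longlonglongrightarrow> f x" by simp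
  qed measurable
  then have "eventually (\<lambda>k. L2_norm (\<lambda>x. F k x - f x) < \<epsilon> / 2) sequentially"
    using e by (intro order_tendstoD) auto
  then obtain k where k: "L2_norm (\<lambda>x. F k x - f x) < \<epsilon> / 2" by (auto simp: eventually_sequentially)
  obtain g where g: "\<And>n. continuous_on UNIV (g n)" and lim: "AE x in lborel. (\<lambda>n. g n x) \<longlonglongrightarrow> f x"
    using borel_measurable_imp_AE_continuous_limit[OF L2_measurable[OF f]] by blast
  define \<phi> where "\<phi> n x = complex_of_real (\<eta> k x) * c k (g n x)" for n x
  have \<phi>_cont: "continuous_on UNIV (\<phi> n)" for n
    unfolding \<phi>_def by (intro continuous_intros \<eta>_cont continuous_on_compose2[OF c_cont g]) auto
  have \<phi>0: "\<phi> n x = 0" "F k x = 0" if "x \<notin> {-(real k + 1)..real k + 1}" for n x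
    using that by (auto simp: \<phi>_def F_def \<eta>_def)
  have bd: "cmod (\<phi> n x) \<le> real k + 1" "cmod (F k x) \<le> real k + 1" for n x
    unfolding \<phi>_def F_def norm_mult
    using mult_mono[OF \<eta>01(2)[of k x] c_bd[of k]] \<eta>01(1)[of k x] by auto
  have FL2: "F k \<in> L2"
    using Fm bd(2) \<phi>0(2) by (rule L2_bounded_support)
  have \<phi>L2: "\<phi> n \<in> L2" for n
    using borel_measurable_continuous_onI[OF \<phi>_cont] bd(1) \<phi>0(1) by (rule L2_bounded_support)
  have "(\<lambda>n. L2_norm (\<lambda>x. \<phi> n x - F k x)) \<longlonglongrightarrow> 0"
  proof (rule L2_dominated_convergence[where w="\<lambda>x. 2 * (real k + 1) * indicator {-(real k + 1)..real k + 1} x"])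
    show "integrable lborel (\<lambda>x. (2 * (real k + 1) * indicator {-(real k + 1)..real k + 1} x)\<^sup>2)"
      unfolding power2_mult_indicator
      by (intro integrable_mult_right integrable_real_indicator) (auto simp: emeasure_lborel_Icc_eq)
    have "cmod (\<phi> n x - F k x) \<le> 2 * (real k + 1) * indicator {-(real k + 1)..real k + 1} x" for n x
      using norm_triangle_ineq4[of "\<phi> n x" "F k x"] bd(1)[of n x] bd(2)[of x] \<phi>0(1)[of x n] \<phi>0(2)[of x] by (auto split: split_indicator)
    then show "AE x in lborel. cmod (\<phi> n x - F k x) \<le> 2 * (real k + 1) * indicator {-(real k + 1)..real k + 1} x" for n
      by simp
    show "AE x in lborel. (\<lambda>n. \<phi> n x) \<longlonglongrightarrow> F k x"
      using lim
    proof eventually_elim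
      case (elim x)
      have "isCont (c k) (f x)" using c_cont[of k] by (simp add: continuous_on_eq_continuous_at)
      then show ?case unfolding \<phi>_def F_def by (intro tendsto_intros isCont_tendsto_compose[OF _ elim])
    qed
  qed (auto intro!: borel_measurable_continuous_onI \<phi>_cont)
  then have "eventually (\<lambda>n. L2_norm (\<lambda>x. \<phi> n x - F k x) < \<epsilon> / 2) sequentially"
    using e by (intro order_tendstoD) auto
  then obtain n where n: "L2_norm (\<lambda>x. \<phi> n x - F k x) < \<epsilon> / 2" by (auto simp: eventually_sequentially)
  have "L2_norm (\<lambda>x. f x - \<phi> n x) < \<epsilon>"
    using L2_norm_diff_triangle[OF \<phi>L2 FL2 f, of n] n k by (simp add: L2_norm_minus_commute[of f])
  then show ?thesis using \<phi>_cont \<phi>0 \<phi>L2 by (intro that) auto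
qed

lemma L2_translate:
  assumes "f \<in> L2"
  shows "(\<lambda>x. f (x + h)) \<in> L2" "L2_norm (\<lambda>x. f (x + h)) = L2_norm f"
proof -
  note [measurable] = L2_measurable[OF assms]
  have "(\<integral>\<^sup>+x. ennreal ((cmod (f (x + h)))\<^sup>2) \<partial>lborel) = (\<integral>\<^sup>+x. ennreal ((cmod (f x))\<^sup>2) \<partial>lborel)"
    using nn_integral_real_affine[of "\<lambda>x. ennreal ((cmod (f x))\<^sup>2)" 1 h] by (simp add: add.commute)
  then have *: "(\<integral>\<^sup>+x. ennreal ((cmod (f (x + h)))\<^sup>2) \<partial>lborel) = ennreal ((L2_norm f)\<^sup>2)"
    by (simp add: nn_integral_L2[OF assms])
  then show 1: "(\<lambda>x. f (x + h)) \<in> L2"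
    by (intro L2I_nn_integral) auto
  show "L2_norm (\<lambda>x. f (x + h)) = L2_norm f"
    using * nn_integral_L2[OF 1] by (simp add: power2_eq_iff_nonneg)
qed

text \<open>Translation is an isometry, so replacing f by a continuous compactly supported function
  costs the same before and after the shift, uniformly in n.\<close>

lemma L2_translation_continuous:
  assumes f: "f \<in> L2" and h: "h \<longlonglongrightarrow> (0::real)"
  shows "(\<lambda>n. L2_norm (\<lambda>x. f (x + h n) - f x)) \<longlonglongrightarrow> 0"
proof (rule LIMSEQ_I)
  fix \<epsilon> :: real assume e: "0 < \<epsilon>"
  obtain \<phi> R where \<phi>: "continuous_on UNIV \<phi>" and \<phi>0: "\<And>x. x \<notin> {-R..R} \<Longrightarrow> \<phi> x = 0" and \<phi>L2: "\<phi> \<in> L2"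
    and close: "L2_norm (\<lambda>x. f x - \<phi> x) < \<epsilon> / 3"
    using L2_dense_continuous[OF f, of "\<epsilon> / 3"] e by auto
  note [measurable] = borel_measurable_continuous_onI[OF \<phi>]
  have "compact (\<phi> ` {-R..R})" by (intro compact_continuous_image continuous_on_subset[OF \<phi>]) auto
  then obtain B where "0 \<le> B" and B: "\<And>x. x \<in> {-R..R} \<Longrightarrow> cmod (\<phi> x) \<le> B"
    using compact_imp_bounded bounded_pos by (metis imageI less_imp_le)
  then have B: "cmod (\<phi> x) \<le> B" for x using \<phi>0[of x] by (cases "x \<in> {-R..R}") auto
  \<comment> \<open>A bound for all shifts puts all translates of \<phi> on one compact
    interval.\<close>
  obtain K where K: "\<And>n. \<bar>h n\<bar> \<le> K"
    using convergent_imp_Bseq[OF convergentI[OF h]] by (auto simp: Bseq_def)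
  have "(\<lambda>n. L2_norm (\<lambda>x. \<phi> (x + h n) - \<phi> x)) \<longlonglongrightarrow> 0"
  proof (rule L2_dominated_convergence[where w="\<lambda>x. 2 * B * indicator {-(R+K)..R+K} x"])
    show "integrable lborel (\<lambda>x. (2 * B * indicator {-(R+K)..R+K} x)\<^sup>2)"
      unfolding power2_mult_indicator
      by (intro integrable_mult_right integrable_real_indicator) (auto simp: emeasure_lborel_Icc_eq)
    have "cmod (\<phi> (x + h n) - \<phi> x) \<le> 2 * B * indicator {-(R+K)..R+K} x" for n x
    proof (cases "x \<in> {-(R+K)..R+K}")
      case True
      then show ?thesis using norm_triangle_ineq4[of "\<phi> (x + h n)" "\<phi> x"] B[of x] B[of "x + h n"] by simp
    next
      case False
      then have "x \<notin> {-R..R}" "x + h n \<notin> {-R..R}" using K[of n] by auto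
      then show ?thesis using \<phi>0 \<open>0 \<le> B\<close> by simp
    qed
    then show "AE x in lborel. cmod (\<phi> (x + h n) - \<phi> x) \<le> 2 * B * indicator {-(R+K)..R+K} x" for n by simp
    have "(\<lambda>n. \<phi> (x + h n)) \<longlonglongrightarrow> \<phi> x" for x
    proof -
      have "isCont \<phi> x" using \<phi> by (simp add: continuous_on_eq_continuous_at)
      moreover have "(\<lambda>n. x + h n) \<longlonglongrightarrow> x" using tendsto_add[OF tendsto_const h, of x] by simp
      ultimately show ?thesis by (rule isCont_tendsto_compose)
    qed
    then show "AE x in lborel. (\<lambda>n. \<phi> (x + h n)) \<longlonglongrightarrow> \<phi> x" by simp
  qed measurable
  then have "eventually (\<lambda>n. L2_norm (\<lambda>x. \<phi> (x + h n) - \<phi> x) < \<epsilon> / 3) sequentially"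
    using e by (intro order_tendstoD) auto
  then obtain N where N: "\<And>n. n \<ge> N \<Longrightarrow> L2_norm (\<lambda>x. \<phi> (x + h n) - \<phi> x) < \<epsilon> / 3"
    unfolding eventually_sequentially by blast
  have "norm (L2_norm (\<lambda>x. f (x + h n) - f x) - 0) < \<epsilon>" if "n \<ge> N" for n
  proof -
    have "L2_norm (\<lambda>x. f (x + h n) - f x) \<le> L2_norm (\<lambda>x. f (x + h n) - \<phi> (x + h n))
        + (L2_norm (\<lambda>x. \<phi> (x + h n) - \<phi> x) + L2_norm (\<lambda>x. \<phi> x - f x))"
      by (intro order_trans[OF L2_norm_diff_triangle add_left_mono] L2_norm_diff_triangle L2_translate f \<phi>L2)
    then show ?thesis
      using N[OF that] close L2_translate(2)[OF L2_diff[OF f \<phi>L2], of "h n"] L2_norm_minus_commute[of f \<phi>] by simp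
  qed
  then show "\<exists>N. \<forall>n\<ge>N. norm (L2_norm (\<lambda>x. f (x + h n) - f x) - 0) < \<epsilon>" by blast
qed

section \<open>The Plancherel theorem\<close>

text \<open>The kernel is that of \<open>is_L2_fourier\<close>, so the truncated integral there is
  \<open>FT\<close> of a cutoff. It is meaningful for integrable functions only.\<close>

definition FT :: "(real \<Rightarrow> complex) \<Rightarrow> real \<Rightarrow> complex" where
  "FT h \<xi> = (LINT x|lborel. cis (- 2 * pi * x * \<xi>) * h x)"

lemma borel_measurable_cis [measurable (raw)]:
  "f \<in> borel_measurable M \<Longrightarrow> (\<lambda>x. cis (f x)) \<in> borel_measurable M"
  by (rule borel_measurable_continuous_on) (intro continuous_intros)

lemma FT_measurable [measurable]:
  assumes [measurable]: "h \<in> borel_measurable borel"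
  shows "FT h \<in> borel_measurable borel"
  unfolding FT_def[abs_def] by measurable

lemma FT_integrable: "integrable lborel h \<Longrightarrow> integrable lborel (\<lambda>x. cis (- 2 * pi * x * \<xi>) * h x)"
  by (rule Bochner_Integration.integrable_bound) (auto simp: norm_mult)

lemma FT_add:
  "integrable lborel f \<Longrightarrow> integrable lborel g \<Longrightarrow> FT (\<lambda>x. f x + g x) \<xi> = FT f \<xi> + FT g \<xi>"
  unfolding FT_def distrib_left by (intro Bochner_Integration.integral_add FT_integrable)

lemma FT_scale: "FT (\<lambda>x. c * f x) \<xi> = c * FT f \<xi>"
  by (simp add: FT_def mult.left_commute[of _ c])

lemma FT_diff:
  "integrable lborel f \<Longrightarrow> integrable lborel g \<Longrightarrow> FT (\<lambda>x. f x - g x) \<xi> = FT f \<xi> - FT g \<xi>"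
  unfolding FT_def right_diff_distrib by (intro Bochner_Integration.integral_diff FT_integrable)

lemma FT_translate: "FT (\<lambda>x. f (x + h)) \<xi> = cis (2 * pi * h * \<xi>) * FT f \<xi>"
proof -
  have "FT f \<xi> = (LINT x|lborel. cis (- 2 * pi * (h + x) * \<xi>) * f (h + x))"
    unfolding FT_def using lborel_integral_real_affine[of 1 "\<lambda>x. cis (- 2 * pi * x * \<xi>) * f x" h] by simp
  also have "\<dots> = (LINT x|lborel. cis (- 2 * pi * h * \<xi>) * (cis (- 2 * pi * x * \<xi>) * f (x + h)))"
  proof (intro Bochner_Integration.integral_cong refl)
    fix x
    have "cis (- 2 * pi * (h + x) * \<xi>) = cis (- 2 * pi * h * \<xi>) * cis (- 2 * pi * x * \<xi>)"
      unfolding cis_mult by (rule arg_cong[where f=cis]) (simp add: algebra_simps)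
    then show "cis (- 2 * pi * (h + x) * \<xi>) * f (h + x) = cis (- 2 * pi * h * \<xi>) * (cis (- 2 * pi * x * \<xi>) * f (x + h))"
      by (simp only: mult.assoc add.commute[of h x])
  qed
  also have "\<dots> = cis (- 2 * pi * h * \<xi>) * FT (\<lambda>x. f (x + h)) \<xi>"
    by (simp add: FT_def)
  finally show ?thesis by (simp add: mult.assoc[symmetric] cis_mult)
qed

lemma norm_FT_le: "cmod (FT h \<xi>) \<le> (LINT x|lborel. cmod (h x))"
  unfolding FT_def using integral_norm_bound[of lborel "\<lambda>x. cis (- 2 * pi * x * \<xi>) * h x"] by (simp add: norm_mult)

text \<open>
  The Fourier transform of the autocorrelation of \<open>h\<close> is \<open>\<bar>FT h\<bar>\<^sup>2\<close>. Integrating this identity against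
  Gaussians that increase to \<open>1\<close> yields Plancherel's identity, because the autocorrelation is
  continuous at \<open>0\<close>, where it equals \<open>\<parallel>h\<parallel>\<^sup>2\<close>.
\<close>

definition autocor :: "(real \<Rightarrow> complex) \<Rightarrow> real \<Rightarrow> complex" where
  "autocor h w = L2_inner (\<lambda>x. h (x + w)) h"

text \<open>|FT h|^2 is a double integral in x and y; after the substitution x = y + w the two
  phases combine into one that depends on w alone.\<close>

lemma autocor_FT:
  assumes int: "integrable lborel h"
  shows "integrable lborel (autocor h)"
    and "complex_of_real ((cmod (FT h \<xi>))\<^sup>2) = (LINT w|lborel. cis (- 2 * pi * w * \<xi>) * autocor h w)"
proof -
  have [measurable]: "h \<in> borel_measurable borel" using int by auto
  define K where "K \<xi> y w = cis (- 2 * pi * w * \<xi>) * (h (y + w) * cnj (h y))" for \<xi> y w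
  have norm_K: "cmod (K \<xi> y w) = cmod (h (y + w)) * cmod (h y)" for \<xi> y w
    by (simp add: K_def norm_mult)
  have shift: "(LINT w|lborel. cmod (h (y + w))) = (LINT w|lborel. cmod (h w))" for y
    using lborel_integral_real_affine[of 1 "\<lambda>x. cmod (h x)" y] by simp
  have hs: "integrable lborel (\<lambda>w. h (y + w))" for y
    using lborel_integrable_real_affine[OF int, of 1 y] by simp
  \<comment> \<open>The section at y has L1 norm ||h||_1 |h y|, so the kernel has total mass
    ||h||_1^2.\<close>
  have K_int: "integrable (lborel \<Otimes>\<^sub>M lborel) (case_prod (K \<xi>))" for \<xi>
  proof (rule lborel_pair.Fubini_integrable)
    show "case_prod (K \<xi>) \<in> borel_measurable (lborel \<Otimes>\<^sub>M lborel)"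
      unfolding K_def by measurable
    show "integrable lborel (\<lambda>y. LINT w|lborel. norm (case (y, w) of (y, w) \<Rightarrow> K \<xi> y w))"
      using int by (simp add: norm_K shift)
    have "integrable lborel (\<lambda>w. K \<xi> y w)" for y
      by (rule Bochner_Integration.integrable_bound[of _ "\<lambda>w. h (y + w) * cnj (h y)"])
         (use hs[of y] in \<open>auto simp: K_def norm_mult\<close>)
    then show "AE y in lborel. integrable lborel (\<lambda>w. case (y, w) of (y, w) \<Rightarrow> K \<xi> y w)" by simp
  qed
  have sw: "(LINT y|lborel. K \<xi> y w) = cis (- 2 * pi * w * \<xi>) * autocor h w" for \<xi> w
    unfolding K_def autocor_def L2_inner_def by simp
  show "integrable lborel (autocor h)"
    using lborel_pair.integrable_snd[OF K_int[of 0]] by (simp add: sw)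
  \<comment> \<open>Translating h by y releases a phase c from \<open>FT h\<close> that cancels the
    conjugate phase of the other factor.\<close>
  have FTs: "FT h \<xi> * cnj (cis (- 2 * pi * y * \<xi>) * h y) = (LINT w|lborel. K \<xi> y w)" for y
  proof -
    define c where "c = cis (- 2 * pi * y * \<xi>)"
    have cc: "c * cnj c = 1" by (simp add: c_def cis_cnj cis_mult)
    have eq: "FT h \<xi> = c * FT (\<lambda>x. h (x + y)) \<xi>"
      by (simp add: c_def FT_translate mult.assoc[symmetric] cis_mult)
    have "FT h \<xi> * cnj (c * h y) = (c * FT (\<lambda>x. h (x + y)) \<xi>) * cnj (c * h y)"
      by (simp only: eq)
    also have "\<dots> = (c * cnj c) * (FT (\<lambda>x. h (x + y)) \<xi> * cnj (h y))"
      unfolding complex_cnj_mult by (simp only: mult_ac)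
    also have "\<dots> = FT (\<lambda>x. h (x + y)) \<xi> * cnj (h y)"
      by (simp only: cc mult_1_left)
    also have "\<dots> = (LINT w|lborel. K \<xi> y w)"
      by (simp add: FT_def K_def mult.assoc add.commute flip: integral_mult_left_zero)
    finally show ?thesis by (simp only: c_def)
  qed
  have "complex_of_real ((cmod (FT h \<xi>))\<^sup>2) = FT h \<xi> * cnj (FT h \<xi>)"
    by (rule complex_norm_square)
  also have "cnj (FT h \<xi>) = (LINT y|lborel. cnj (cis (- 2 * pi * y * \<xi>) * h y))"
    unfolding FT_def by (rule Bochner_Integration.integral_cnj[symmetric])
  also have "FT h \<xi> * \<dots> = (LINT y|lborel. FT h \<xi> * cnj (cis (- 2 * pi * y * \<xi>) * h y))"
    by (rule integral_mult_right_zero[symmetric])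
  also have "\<dots> = (LINT y|lborel. LINT w|lborel. K \<xi> y w)"
    by (simp only: FTs)
  also have "\<dots> = (LINT w|lborel. LINT y|lborel. K \<xi> y w)"
    by (rule lborel_pair.Fubini_integral[OF K_int, symmetric])
  also have "\<dots> = (LINT w|lborel. cis (- 2 * pi * w * \<xi>) * autocor h w)"
    by (simp only: sw)
  finally show "complex_of_real ((cmod (FT h \<xi>))\<^sup>2) = (LINT w|lborel. cis (- 2 * pi * w * \<xi>) * autocor h w)" .
qed

text \<open>The characteristic function of the standard normal distribution.\<close>

lemma integral_std_normal_cis:
  "(LINT x|lborel. complex_of_real (std_normal_density x) * cis (t * x)) = complex_of_real (exp (- (t\<^sup>2) / 2))"
proof -
  have "(LINT x|lborel. complex_of_real (std_normal_density x) * cis (t * x)) = char std_normal_distribution t"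
    unfolding char_def
    by (subst integral_density) (auto simp: cis_conv_exp scaleR_conv_of_real mult.commute)
  then show ?thesis by (simp add: char_std_normal_distribution)
qed

lemma integrable_std_normal: "integrable lborel std_normal_density"
  using integrable_normal_density[of 1 0] by simp

text \<open>After inserting the autocorrelation formula and exchanging integrals, the inner integral
  is the Gaussian characteristic function at -2 pi w/\<epsilon>.\<close>

lemma FT_Gaussian_mean:
  assumes int: "integrable lborel h" and e: "0 < (\<epsilon>::real)"
  shows "(LINT \<xi>|lborel. complex_of_real (std_normal_density \<xi> * (cmod (FT h (\<xi> / \<epsilon>)))\<^sup>2))
       = (LINT w|lborel. complex_of_real (exp (- ((2 * pi * w / \<epsilon>)\<^sup>2) / 2)) * autocor h w)"
proof -
  note c_int = autocor_FT(1)[OF int]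
  have [measurable]: "autocor h \<in> borel_measurable borel" using c_int by auto
  define K where "K \<xi> w = complex_of_real (std_normal_density \<xi>) * (cis (- 2 * pi * w * (\<xi> / \<epsilon>)) * autocor h w)" for \<xi> w
  have norm_K: "cmod (K \<xi> w) = std_normal_density \<xi> * cmod (autocor h w)" for \<xi> w
    by (simp add: K_def norm_mult)
  have K_int: "integrable (lborel \<Otimes>\<^sub>M lborel) (case_prod K)"
  proof (rule lborel_pair.Fubini_integrable)
    show "case_prod K \<in> borel_measurable (lborel \<Otimes>\<^sub>M lborel)"
      unfolding K_def by measurable
    show "integrable lborel (\<lambda>\<xi>. LINT w|lborel. norm (case (\<xi>, w) of (\<xi>, w) \<Rightarrow> K \<xi> w))"
      using integrable_std_normal by (simp add: norm_K)
    have "integrable lborel (\<lambda>w. K \<xi> w)" for \<xi>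
      by (rule Bochner_Integration.integrable_bound[of _ "\<lambda>w. complex_of_real (std_normal_density \<xi>) * autocor h w"])
         (use c_int in \<open>auto simp: K_def norm_mult\<close>)
    then show "AE \<xi> in lborel. integrable lborel (\<lambda>w. case (\<xi>, w) of (\<xi>, w) \<Rightarrow> K \<xi> w)" by simp
  qed
  have "(LINT \<xi>|lborel. complex_of_real (std_normal_density \<xi> * (cmod (FT h (\<xi> / \<epsilon>)))\<^sup>2)) 
      = (LINT \<xi>|lborel. LINT w|lborel. K \<xi> w)"
    unfolding of_real_mult autocor_FT(2)[OF int] K_def by simp
  also have "\<dots> = (LINT w|lborel. LINT \<xi>|lborel. K \<xi> w)"
    by (rule lborel_pair.Fubini_integral[OF K_int, symmetric])
  also have "\<dots> = (LINT w|lborel. complex_of_real (exp (- ((2 * pi * w / \<epsilon>)\<^sup>2) / 2)) * autocor h w)"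
  proof (intro Bochner_Integration.integral_cong refl)
    fix w
    have "(LINT \<xi>|lborel. K \<xi> w) = (LINT \<xi>|lborel. complex_of_real (std_normal_density \<xi>) * cis ((- 2 * pi * w / \<epsilon>) * \<xi>)) * autocor h w"
      unfolding K_def integral_mult_left_zero[symmetric] by (simp add: mult.assoc)
    then show "(LINT \<xi>|lborel. K \<xi> w) = complex_of_real (exp (- ((2 * pi * w / \<epsilon>)\<^sup>2) / 2)) * autocor h w"
      unfolding integral_std_normal_cis by simp
  qed
  finally show ?thesis .
qed

text \<open>Rescaling both sides produces the same factor \<epsilon>/sqrt(2 pi). Once it is
  cancelled, the left weight increases to 1 as \<epsilon> decreases to 0, and the right side is a
  probability average of the autocorrelation at points tending to 0.\<close>

lemma FT_Gaussian_mean':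
  assumes int: "integrable lborel h" and e: "0 < (\<epsilon>::real)"
  shows "complex_of_real (LINT \<xi>|lborel. exp (- ((\<epsilon> * \<xi>)\<^sup>2) / 2) * (cmod (FT h \<xi>))\<^sup>2)
       = (LINT v|lborel. complex_of_real (std_normal_density v) * autocor h (\<epsilon> * v / (2 * pi)))"
proof -
  have dens: "std_normal_density x = exp (- (x\<^sup>2) / 2) / sqrt (2 * pi)" for x
    by (simp add: normal_density_def)
  have "(LINT \<xi>|lborel. complex_of_real (std_normal_density \<xi> * (cmod (FT h (\<xi> / \<epsilon>)))\<^sup>2))
     = \<epsilon> *\<^sub>R (LINT \<xi>|lborel. complex_of_real (std_normal_density (\<epsilon> * \<xi>) * (cmod (FT h \<xi>))\<^sup>2))"
    using e by (subst lborel_integral_real_affine[of \<epsilon> _ 0]) auto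
  also have "\<dots> = complex_of_real (\<epsilon> / sqrt (2 * pi)) * complex_of_real (LINT \<xi>|lborel. exp (- ((\<epsilon> * \<xi>)\<^sup>2) / 2) * (cmod (FT h \<xi>))\<^sup>2)"
    unfolding integral_complex_of_real dens by (simp add: scaleR_conv_of_real)
  finally have 1: "(LINT \<xi>|lborel. complex_of_real (std_normal_density \<xi> * (cmod (FT h (\<xi> / \<epsilon>)))\<^sup>2)) = \<dots>" .
  have "(LINT w|lborel. complex_of_real (exp (- ((2 * pi * w / \<epsilon>)\<^sup>2) / 2)) * autocor h w)
     = (\<epsilon> / (2 * pi)) *\<^sub>R (LINT v|lborel. complex_of_real (exp (- (v\<^sup>2) / 2)) * autocor h (\<epsilon> * v / (2 * pi)))"
    using e by (subst lborel_integral_real_affine[of "\<epsilon> / (2 * pi)" _ 0]) auto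
  also have "\<dots> = complex_of_real (\<epsilon> / (2 * pi) * sqrt (2 * pi)) * (LINT v|lborel. complex_of_real (std_normal_density v) * autocor h (\<epsilon> * v / (2 * pi)))"
    unfolding dens by (simp add: scaleR_conv_of_real)
  also have "\<epsilon> / (2 * pi) * sqrt (2 * pi) = \<epsilon> / sqrt (2 * pi)"
    using real_sqrt_pow2[of "2 * pi"] by (simp add: field_simps power2_eq_square)
  finally show ?thesis
    using 1 FT_Gaussian_mean[OF assms] e by simp
qed

lemma autocor_continuous:
  assumes h: "h \<in> L2" and w: "w \<longlonglongrightarrow> (0::real)"
  shows "(\<lambda>n. autocor h (w n)) \<longlonglongrightarrow> complex_of_real ((L2_norm h)\<^sup>2)"
proof -
  have "(\<lambda>n. autocor h (w n) - complex_of_real ((L2_norm h)\<^sup>2)) \<longlonglongrightarrow> 0"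
  proof (rule Lim_null_comparison)
    show "(\<lambda>n. L2_norm (\<lambda>x. h (x + w n) - h x) * L2_norm h) \<longlonglongrightarrow> 0"
      using tendsto_mult[OF L2_translation_continuous[OF assms] tendsto_const] by simp
    have "norm (autocor h (w n) - complex_of_real ((L2_norm h)\<^sup>2)) \<le> L2_norm (\<lambda>x. h (x + w n) - h x) * L2_norm h" for n
      using L2_inner_bound[OF L2_diff[OF L2_translate(1)[OF h] h] h, of "w n"] h
      by (simp add: L2_inner_diff_left L2_translate autocor_def L2_inner_self)
    then show "eventually (\<lambda>n. norm (autocor h (w n) - complex_of_real ((L2_norm h)\<^sup>2)) \<le> L2_norm (\<lambda>x. h (x + w n) - h x) * L2_norm h) sequentially"
      by simp
  qed
  then show ?thesis by (simp add: LIM_zero_iff)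
qed

theorem Plancherel_L1_L2:
  assumes int: "integrable lborel h" and h: "h \<in> L2"
  shows "FT h \<in> L2" "L2_norm (FT h) = L2_norm h"
proof -
  have [measurable]: "h \<in> borel_measurable borel" using int by auto
  have [measurable]: "autocor h \<in> borel_measurable borel" using autocor_FT(1)[OF int] by auto
  define \<epsilon> where "\<epsilon> n = inverse (real (Suc n))" for n
  have \<epsilon>: "0 < \<epsilon> n" for n by (simp add: \<epsilon>_def)
  have \<epsilon>0: "\<epsilon> \<longlonglongrightarrow> 0" unfolding \<epsilon>_def by (rule LIMSEQ_inverse_real_of_nat)
  define f where "f n \<xi> = exp (- ((\<epsilon> n * \<xi>)\<^sup>2) / 2) * (cmod (FT h \<xi>))\<^sup>2" for n \<xi>
  define M where "M = (LINT x|lborel. cmod (h x))"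
  \<comment> \<open>Square integrability of \<open>FT h\<close> is not yet known; its boundedness by
    ||h||_1 and the Gaussian factor suffice here.\<close>
  have f_int: "integrable lborel (f n)" for n
  proof (rule integrable_nonneg_bound)
    have "integrable lborel (\<lambda>x. std_normal_density (0 + \<epsilon> n * x))"
      using \<epsilon>[of n] by (intro lborel_integrable_real_affine integrable_std_normal) simp
    then show "integrable lborel (\<lambda>x. (sqrt (2 * pi) * M\<^sup>2) * std_normal_density (0 + \<epsilon> n * x))" by simp
    show "f n \<xi> \<le> (sqrt (2 * pi) * M\<^sup>2) * std_normal_density (0 + \<epsilon> n * \<xi>)" for \<xi>
    proof -
      have "f n \<xi> \<le> exp (- ((\<epsilon> n * \<xi>)\<^sup>2) / 2) * M\<^sup>2"
        unfolding f_def M_def by (intro mult_left_mono power_mono norm_FT_le) auto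
      then show ?thesis by (simp add: normal_density_def mult.commute)
    qed
    show "f n \<in> borel_measurable lborel" unfolding f_def by measurable
  qed (simp add: f_def)
  have lim: "(\<lambda>n. complex_of_real (integral\<^sup>L lborel (f n))) \<longlonglongrightarrow> 
      (LINT v|lborel. complex_of_real (std_normal_density v) * complex_of_real ((L2_norm h)\<^sup>2))"
    unfolding f_def FT_Gaussian_mean'[OF int \<epsilon>]
  proof (rule integral_dominated_convergence[where w="\<lambda>v. std_normal_density v * (L2_norm h)\<^sup>2"])
    show "integrable lborel (\<lambda>v. std_normal_density v * (L2_norm h)\<^sup>2)"
      using integrable_std_normal by simp
    have "(\<lambda>n. complex_of_real (std_normal_density v) * autocor h (\<epsilon> n * v / (2 * pi)))
        \<longlonglongrightarrow> complex_of_real (std_normal_density v) * complex_of_real ((L2_norm h)\<^sup>2)" for v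
      by (intro tendsto_intros autocor_continuous[OF h]) (auto intro!: tendsto_eq_intros \<epsilon>0)
    then show "AE v in lborel. (\<lambda>n. complex_of_real (std_normal_density v) * autocor h (\<epsilon> n * v / (2 * pi)))
        \<longlonglongrightarrow> complex_of_real (std_normal_density v) * complex_of_real ((L2_norm h)\<^sup>2)" by simp
    have "cmod (autocor h w) \<le> (L2_norm h)\<^sup>2" for w
      unfolding autocor_def using L2_inner_bound[OF L2_translate(1)[OF h] h, of w]
      by (simp add: L2_translate[OF h] power2_eq_square)
    then have "norm (complex_of_real (std_normal_density v) * autocor h (\<epsilon> n * v / (2 * pi))) \<le> std_normal_density v * (L2_norm h)\<^sup>2" for n v
      by (simp add: norm_mult mult_left_mono)
    then show "AE v in lborel. norm (complex_of_real (std_normal_density v) * autocor h (\<epsilon> n * v / (2 * pi))) \<le> std_normal_density v * (L2_norm h)\<^sup>2" for n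
      by simp
  qed measurable
  have "(LINT v|lborel. complex_of_real (std_normal_density v) * complex_of_real ((L2_norm h)\<^sup>2)) = complex_of_real ((L2_norm h)\<^sup>2)"
    using integral_std_normal_cis[of 0] by simp
  with lim have lim': "(\<lambda>n. integral\<^sup>L lborel (f n)) \<longlonglongrightarrow> (L2_norm h)\<^sup>2"
    by (metis tendsto_of_real_iff)
  have mono: "mono (\<lambda>n. f n \<xi>)" for \<xi>
  proof (rule monoI)
    fix m n :: nat assume "m \<le> n"
    then have "\<epsilon> n \<le> \<epsilon> m" by (simp add: \<epsilon>_def)
    then have "(\<epsilon> n)\<^sup>2 \<le> (\<epsilon> m)\<^sup>2" using \<epsilon>[of n] by (intro power_mono) auto
    then have "(\<epsilon> n * \<xi>)\<^sup>2 \<le> (\<epsilon> m * \<xi>)\<^sup>2" unfolding power_mult_distrib by (intro mult_right_mono) auto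
    then show "f m \<xi> \<le> f n \<xi>" unfolding f_def by (intro mult_right_mono) auto
  qed
  have pt: "(\<lambda>n. f n \<xi>) \<longlonglongrightarrow> (cmod (FT h \<xi>))\<^sup>2" for \<xi>
    unfolding f_def by (auto intro!: tendsto_eq_intros \<epsilon>0)
  have nn: "0 \<le> f n \<xi>" for n \<xi> by (simp add: f_def)
  \<comment> \<open>Monotone convergence yields the integrability of the limit together with its
    integral.\<close>
  have 1: "integrable lborel (\<lambda>\<xi>. (cmod (FT h \<xi>))\<^sup>2)" "(LINT \<xi>|lborel. (cmod (FT h \<xi>))\<^sup>2) = (L2_norm h)\<^sup>2"
    by (rule integral_monotone_convergence_nonneg[OF f_int _ _ _ lim']; simp add: mono nn pt)+
  show "FT h \<in> L2" using 1(1) by (simp add: L2_def)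
  show "L2_norm (FT h) = L2_norm h" using 1(2) by (simp add: L2_norm_def)
qed

section \<open>The Fourier transform of square integrable functions\<close>

lemma cutoff_L2:
  assumes "f \<in> L2"
  shows "cutoff R f \<in> L2" "L2_norm (cutoff R f) \<le> L2_norm f"
proof -
  note [measurable] = L2_measurable[OF assms]
  have m: "cutoff R f \<in> borel_measurable borel" unfolding cutoff_def by measurable
  have le: "AE x in lborel. cmod (cutoff R f x) \<le> 1 * cmod (f x)"
    by (auto simp: cutoff_def split: split_indicator)
  show "cutoff R f \<in> L2" "L2_norm (cutoff R f) \<le> L2_norm f"
    using L2_bound[OF assms m le] by simp_all
qed

text \<open>On a bounded interval L2 is contained in L1: Cauchy-Schwarz against the
  indicator.\<close>

lemma cutoff_integrable:
  assumes "f \<in> L2" shows "integrable lborel (cutoff R f)"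
proof -
  note [measurable] = L2_measurable[OF assms]
  have ind: "(\<lambda>x. indicator {-R..R} x) \<in> L2"
    by (rule L2_bounded_support[of _ 1 "-R" R]) (auto split: split_indicator)
  show ?thesis
    by (rule Bochner_Integration.integrable_bound[OF L2_integrable_mult[OF ind assms]])
       (auto simp: cutoff_def norm_mult)
qed

lemma cutoff_add: "cutoff R (\<lambda>x. f x + g x) = (\<lambda>x. cutoff R f x + cutoff R g x)"
  by (simp add: cutoff_def fun_eq_iff distrib_left)

lemma cutoff_diff: "cutoff R (\<lambda>x. f x - g x) = (\<lambda>x. cutoff R f x - cutoff R g x)"
  by (simp add: cutoff_def fun_eq_iff right_diff_distrib)

lemma cutoff_scale: "cutoff R (\<lambda>x. c * f x) = (\<lambda>x. c * cutoff R f x)"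
  by (simp add: cutoff_def fun_eq_iff mult.left_commute)

lemma cutoff_tendsto:
  assumes "f \<in> L2" shows "((\<lambda>R. L2_norm (\<lambda>x. cutoff R f x - f x)) \<longlongrightarrow> 0) at_top"
proof (rule tendsto_at_topI_sequentially)
  fix X :: "nat \<Rightarrow> real" assume X: "filterlim X at_top sequentially"
  show "(\<lambda>n. L2_norm (\<lambda>x. cutoff (X n) f x - f x)) \<longlonglongrightarrow> 0"
  proof (rule L2_dominated_convergence[where w="\<lambda>x. cmod (f x)"])
    have "(\<lambda>n. cutoff (X n) f x) \<longlonglongrightarrow> f x" for x
    proof (rule tendsto_eventually)
      have "eventually (\<lambda>n. \<bar>x\<bar> \<le> X n) sequentially" using X by (simp add: filterlim_at_top)
      then show "eventually (\<lambda>n. cutoff (X n) f x = f x) sequentially"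
        by eventually_elim (auto simp: cutoff_def split: split_indicator)
    qed
    then show "AE x in lborel. (\<lambda>n. cutoff (X n) f x) \<longlonglongrightarrow> f x" by simp
    show "AE x in lborel. cmod (cutoff (X n) f x - f x) \<le> cmod (f x)" for n
      by (auto simp: cutoff_def split: split_indicator)
  qed (use assms cutoff_L2[OF assms] in \<open>auto simp: L2_integrable L2_measurable\<close>)
qed

lemma FT_cutoff: "FT (cutoff R f) \<xi> = (LINT x:{-R..R}|lborel. cis (- 2 * pi * x * \<xi>) * f x)"
  unfolding FT_def set_lebesgue_integral_def cutoff_def
  by (intro Bochner_Integration.integral_cong) (auto split: split_indicator)

lemma FT_cutoff_L2:
  assumes "f \<in> L2"
  shows "FT (cutoff R f) \<in> L2" "L2_norm (FT (cutoff R f)) = L2_norm (cutoff R f)"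
  using Plancherel_L1_L2[OF cutoff_integrable cutoff_L2(1)] assms by auto

text \<open>By Plancherel the truncated transforms lie in L2, so the extended integral in the
  definition is finite and equals a squared norm.\<close>

lemma is_L2_fourier_iff:
  assumes f: "f \<in> L2"
  shows "is_L2_fourier f g \<longleftrightarrow> g \<in> L2 \<and> ((\<lambda>R. L2_norm (\<lambda>\<xi>. FT (cutoff R f) \<xi> - g \<xi>)) \<longlongrightarrow> 0) at_top"
proof (cases "g \<in> L2")
  case True
  have eq: "(\<integral>\<^sup>+\<xi>. ennreal ((cmod ((LINT x:{-R..R}|lborel. cis (- 2 * pi * x * \<xi>) * f x) - g \<xi>))\<^sup>2) \<partial>lborel)
     = ennreal ((L2_norm (\<lambda>\<xi>. FT (cutoff R f) \<xi> - g \<xi>))\<^sup>2)" for R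
    unfolding FT_cutoff[symmetric] by (rule nn_integral_L2[OF L2_diff[OF FT_cutoff_L2(1)[OF f] True]])
  let ?N = "\<lambda>R. L2_norm (\<lambda>\<xi>. FT (cutoff R f) \<xi> - g \<xi>)"
  have "((\<lambda>R. ennreal ((?N R)\<^sup>2)) \<longlongrightarrow> 0) at_top \<longleftrightarrow> ((\<lambda>R. (?N R)\<^sup>2) \<longlongrightarrow> 0) at_top"
    by (subst tendsto_ennreal_iff[symmetric]) auto
  also have "\<dots> \<longleftrightarrow> (?N \<longlongrightarrow> 0) at_top"
    using tendsto_real_sqrt[of "\<lambda>R. (?N R)\<^sup>2" 0 at_top] tendsto_power[of ?N 0 at_top 2] by auto
  finally show ?thesis unfolding is_L2_fourier_def eq using True by blast
qed (simp add: is_L2_fourier_def)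

lemma is_L2_fourier_mem: "is_L2_fourier f g \<Longrightarrow> g \<in> L2"
  by (simp add: is_L2_fourier_def)

lemma is_L2_fourier_add:
  assumes f: "f1 \<in> L2" "f2 \<in> L2" and F: "is_L2_fourier f1 g1" "is_L2_fourier f2 g2"
  shows "is_L2_fourier (\<lambda>x. f1 x + f2 x) (\<lambda>x. g1 x + g2 x)"
proof -
  note g = is_L2_fourier_mem[OF F(1)] is_L2_fourier_mem[OF F(2)]
  have "((\<lambda>R. L2_norm (\<lambda>\<xi>. FT (cutoff R (\<lambda>x. f1 x + f2 x)) \<xi> - (g1 \<xi> + g2 \<xi>))) \<longlongrightarrow> 0) at_top"
  proof (rule tendsto_sandwich[OF _ _ tendsto_const])
    show "((\<lambda>R. L2_norm (\<lambda>\<xi>. FT (cutoff R f1) \<xi> - g1 \<xi>) + L2_norm (\<lambda>\<xi>. FT (cutoff R f2) \<xi> - g2 \<xi>)) \<longlongrightarrow> 0) at_top"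
      using F f by (auto simp: is_L2_fourier_iff intro: tendsto_add_zero)
    have "L2_norm (\<lambda>\<xi>. FT (cutoff R (\<lambda>x. f1 x + f2 x)) \<xi> - (g1 \<xi> + g2 \<xi>))
       \<le> L2_norm (\<lambda>\<xi>. FT (cutoff R f1) \<xi> - g1 \<xi>) + L2_norm (\<lambda>\<xi>. FT (cutoff R f2) \<xi> - g2 \<xi>)" for R
      using L2_norm_triangle[OF L2_diff[OF FT_cutoff_L2(1)[OF f(1)] g(1)] L2_diff[OF FT_cutoff_L2(1)[OF f(2)] g(2)], of R R]
      by (simp add: cutoff_add FT_add cutoff_integrable f algebra_simps)
    then show "eventually (\<lambda>R. L2_norm (\<lambda>\<xi>. FT (cutoff R (\<lambda>x. f1 x + f2 x)) \<xi> - (g1 \<xi> + g2 \<xi>))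
       \<le> L2_norm (\<lambda>\<xi>. FT (cutoff R f1) \<xi> - g1 \<xi>) + L2_norm (\<lambda>\<xi>. FT (cutoff R f2) \<xi> - g2 \<xi>)) at_top" by simp
  qed simp
  then show ?thesis using f g by (simp add: is_L2_fourier_iff L2_add)
qed

lemma is_L2_fourier_scale:
  assumes f: "f \<in> L2" and F: "is_L2_fourier f g"
  shows "is_L2_fourier (\<lambda>x. c * f x) (\<lambda>x. c * g x)"
proof -
  have "L2_norm (\<lambda>\<xi>. FT (cutoff R (\<lambda>x. c * f x)) \<xi> - c * g \<xi>) = cmod c * L2_norm (\<lambda>\<xi>. FT (cutoff R f) \<xi> - g \<xi>)" for R
    by (simp add: cutoff_scale FT_scale right_diff_distrib[symmetric] L2_norm_scale)
  then show ?thesis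
    using F f by (simp add: is_L2_fourier_iff L2_scale tendsto_mult_right_zero)
qed

lemma is_L2_fourier_diff:
  assumes f: "f1 \<in> L2" "f2 \<in> L2" and F: "is_L2_fourier f1 g1" "is_L2_fourier f2 g2"
  shows "is_L2_fourier (\<lambda>x. f1 x - f2 x) (\<lambda>x. g1 x - g2 x)"
  using is_L2_fourier_add[OF f(1) L2_scale[OF f(2)] F(1) is_L2_fourier_scale[OF f(2) F(2)], of "-1"] by simp

lemma L2_norm_tendsto:
  assumes "\<And>i. f i \<in> L2" "g \<in> L2" and lim: "((\<lambda>i. L2_norm (\<lambda>x. f i x - g x)) \<longlongrightarrow> 0) F"
  shows "((\<lambda>i. L2_norm (f i)) \<longlongrightarrow> L2_norm g) F"
proof -
  have "((\<lambda>i. L2_norm (f i) - L2_norm g) \<longlongrightarrow> 0) F"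
    by (rule Lim_null_comparison[OF _ lim]) (simp add: L2_norm_diff_ge assms)
  then show ?thesis by (simp add: LIM_zero_iff)
qed

text \<open>The norms of the truncated transforms equal those of the truncations, and a limit is
  unique.\<close>

lemma is_L2_fourier_norm:
  assumes f: "f \<in> L2" and F: "is_L2_fourier f g"
  shows "L2_norm g = L2_norm f"
proof (rule tendsto_unique)
  show "((\<lambda>R. L2_norm (FT (cutoff R f))) \<longlongrightarrow> L2_norm g) at_top"
    using F f by (intro L2_norm_tendsto FT_cutoff_L2) (auto simp: is_L2_fourier_iff)
  show "((\<lambda>R. L2_norm (FT (cutoff R f))) \<longlongrightarrow> L2_norm f) at_top"
    unfolding FT_cutoff_L2(2)[OF f] using f by (intro L2_norm_tendsto cutoff_L2 cutoff_tendsto)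
qed simp

text \<open>The difference of two transforms of f is a transform of 0, hence has norm 0.\<close>

lemma is_L2_fourier_unique:
  assumes f: "f \<in> L2" and F: "is_L2_fourier f g" "is_L2_fourier f g'"
  shows "AE \<xi> in lborel. g \<xi> = g' \<xi>"
proof -
  have "is_L2_fourier (\<lambda>x. 0) (\<lambda>\<xi>. g \<xi> - g' \<xi>)"
    using is_L2_fourier_diff[OF f f F] by simp
  then have "L2_norm (\<lambda>\<xi>. g \<xi> - g' \<xi>) = 0"
    using is_L2_fourier_norm[OF L2_zero] by simp
  then show ?thesis
    using L2_norm_eq_0_iff_AE[OF L2_diff] is_L2_fourier_mem[OF F(1)] is_L2_fourier_mem[OF F(2)] by simp
qed

text \<open>Closedness of the transform as a relation. Truncation is a contraction and
  \<open>FT\<close> an isometry on truncations, so replacing f' by f n costs at most their distance,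
  uniformly in R.\<close>

lemma is_L2_fourier_limit:
  assumes f: "\<And>n::nat. f n \<in> L2" "f' \<in> L2" "(\<lambda>n. L2_norm (\<lambda>x. f n x - f' x)) \<longlonglongrightarrow> 0"
    and F: "\<And>n. is_L2_fourier (f n) (g n)"
    and g: "g' \<in> L2" "(\<lambda>n. L2_norm (\<lambda>x. g n x - g' x)) \<longlonglongrightarrow> 0"
  shows "is_L2_fourier f' g'"
proof -
  have "((\<lambda>R. L2_norm (\<lambda>\<xi>. FT (cutoff R f') \<xi> - g' \<xi>)) \<longlongrightarrow> 0) at_top"
  proof (rule tendstoI)
    fix \<epsilon> :: real assume e: "0 < \<epsilon>"
    have "eventually (\<lambda>n. L2_norm (\<lambda>x. f n x - f' x) < \<epsilon> / 3 \<and> L2_norm (\<lambda>x. g n x - g' x) < \<epsilon> / 3) sequentially"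
      using e by (intro eventually_conj order_tendstoD(2)[OF f(3)] order_tendstoD(2)[OF g(2)]) auto
    then obtain n where n: "L2_norm (\<lambda>x. f n x - f' x) < \<epsilon> / 3" "L2_norm (\<lambda>x. g n x - g' x) < \<epsilon> / 3"
      by (auto simp: eventually_sequentially)
    have "((\<lambda>R. L2_norm (\<lambda>\<xi>. FT (cutoff R (f n)) \<xi> - g n \<xi>)) \<longlongrightarrow> 0) at_top"
      using F[of n] f(1) by (simp add: is_L2_fourier_iff)
    then have "eventually (\<lambda>R. L2_norm (\<lambda>\<xi>. FT (cutoff R (f n)) \<xi> - g n \<xi>) < \<epsilon> / 3) at_top"
      using e by (intro order_tendstoD) auto
    then show "eventually (\<lambda>R. dist (L2_norm (\<lambda>\<xi>. FT (cutoff R f') \<xi> - g' \<xi>)) 0 < \<epsilon>) at_top"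
    proof eventually_elim
      case (elim R)
      have "L2_norm (\<lambda>\<xi>. FT (cutoff R f') \<xi> - FT (cutoff R (f n)) \<xi>) = L2_norm (cutoff R (\<lambda>x. f' x - f n x))"
        using FT_cutoff_L2(2)[OF L2_diff[OF f(2) f(1)], of R n]
        unfolding cutoff_diff FT_diff[OF cutoff_integrable[OF f(2)] cutoff_integrable[OF f(1)], abs_def] .
      also have "\<dots> \<le> L2_norm (\<lambda>x. f' x - f n x)" by (intro cutoff_L2 L2_diff f)
      finally have 1: "L2_norm (\<lambda>\<xi>. FT (cutoff R f') \<xi> - FT (cutoff R (f n)) \<xi>) < \<epsilon> / 3"
        using n(1) by (simp add: L2_norm_minus_commute[of f'])
      have "L2_norm (\<lambda>\<xi>. FT (cutoff R f') \<xi> - g' \<xi>) \<le> L2_norm (\<lambda>\<xi>. FT (cutoff R f') \<xi> - FT (cutoff R (f n)) \<xi>)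
        + (L2_norm (\<lambda>\<xi>. FT (cutoff R (f n)) \<xi> - g n \<xi>) + L2_norm (\<lambda>x. g n x - g' x))"
        by (intro order_trans[OF L2_norm_diff_triangle add_left_mono] L2_norm_diff_triangle FT_cutoff_L2 f g is_L2_fourier_mem[OF F])
      then show ?case using 1 n(2) elim by simp
    qed
  qed
  then show ?thesis using f g by (simp add: is_L2_fourier_iff)
qed

text \<open>Truncation does not commute with translation. For the translate of the truncation the
  formula is exact; its L2 distance to the truncation of the translate vanishes as R grows.\<close>

lemma is_L2_fourier_translate:
  assumes f: "f \<in> L2" and F: "is_L2_fourier f g"
  shows "is_L2_fourier (\<lambda>x. f (x + h)) (\<lambda>\<xi>. cis (2 * pi * h * \<xi>) * g \<xi>)"
proof -
  note g = is_L2_fourier_mem[OF F]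
  note [measurable] = L2_measurable[OF g] L2_measurable[OF FT_cutoff_L2(1)[OF f]]
  let ?f = "\<lambda>x. f (x + h)"
  have fh: "?f \<in> L2" by (rule L2_translate[OF f])
  have eg: "(\<lambda>\<xi>. cis (2 * pi * h * \<xi>) * u \<xi>) \<in> L2" if "u \<in> L2" for u
    using L2_measurable[OF that] by (intro L2_bound(1)[OF that, of _ 1]) (auto simp: norm_mult)
  have "((\<lambda>R. L2_norm (\<lambda>\<xi>. FT (cutoff R ?f) \<xi> - cis (2 * pi * h * \<xi>) * g \<xi>)) \<longlongrightarrow> 0) at_top"
  proof (rule tendsto_sandwich[OF _ _ tendsto_const])
    have "((\<lambda>R. L2_norm (\<lambda>x. cutoff R ?f x - ?f x) + L2_norm (\<lambda>x. cutoff R f x - f x)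
        + L2_norm (\<lambda>\<xi>. FT (cutoff R f) \<xi> - g \<xi>)) \<longlongrightarrow> 0 + 0 + 0) at_top"
      using F f fh by (intro tendsto_add cutoff_tendsto) (auto simp: is_L2_fourier_iff)
    then show "((\<lambda>R. L2_norm (\<lambda>x. cutoff R ?f x - ?f x) + L2_norm (\<lambda>x. cutoff R f x - f x)
        + L2_norm (\<lambda>\<xi>. FT (cutoff R f) \<xi> - g \<xi>)) \<longlongrightarrow> 0) at_top" by simp
    have "L2_norm (\<lambda>\<xi>. FT (cutoff R ?f) \<xi> - cis (2 * pi * h * \<xi>) * g \<xi>)
       \<le> L2_norm (\<lambda>x. cutoff R ?f x - ?f x) + L2_norm (\<lambda>x. cutoff R f x - f x)
        + L2_norm (\<lambda>\<xi>. FT (cutoff R f) \<xi> - g \<xi>)" for R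
    proof -
      let ?c = "\<lambda>x. cutoff R f (x + h)"
      have cL2: "?c \<in> L2" by (intro L2_translate cutoff_L2 f)
      have cint: "integrable lborel ?c"
        using lborel_integrable_real_affine[OF cutoff_integrable[OF f], of 1 R h] by (simp add: add.commute)
      have FTc: "FT ?c \<xi> = cis (2 * pi * h * \<xi>) * FT (cutoff R f) \<xi>" for \<xi>
        by (rule FT_translate)
      have dint: "integrable lborel (\<lambda>x. cutoff R ?f x - ?c x)"
        by (intro Bochner_Integration.integrable_diff cint cutoff_integrable fh)
      have "L2_norm (\<lambda>\<xi>. FT (cutoff R ?f) \<xi> - FT ?c \<xi>) = L2_norm (FT (\<lambda>x. cutoff R ?f x - ?c x))"
        by (simp add: FT_diff[OF cutoff_integrable[OF fh] cint, abs_def])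
      also have "\<dots> = L2_norm (\<lambda>x. cutoff R ?f x - ?c x)"
        by (intro Plancherel_L1_L2 dint L2_diff cutoff_L2 fh cL2)
      also have "\<dots> \<le> L2_norm (\<lambda>x. cutoff R ?f x - ?f x) + L2_norm (\<lambda>x. ?f x - ?c x)"
        by (intro L2_norm_diff_triangle cutoff_L2 fh cL2)
      also have "L2_norm (\<lambda>x. ?f x - ?c x) = L2_norm (\<lambda>x. cutoff R f x - f x)"
        using L2_translate(2)[OF L2_diff[OF f cutoff_L2(1)[OF f]], of h R] by (simp add: L2_norm_minus_commute[of f])
      finally have 1: "L2_norm (\<lambda>\<xi>. FT (cutoff R ?f) \<xi> - FT ?c \<xi>) \<le> 
        L2_norm (\<lambda>x. cutoff R ?f x - ?f x) + L2_norm (\<lambda>x. cutoff R f x - f x)" .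
      have 2: "L2_norm (\<lambda>\<xi>. FT ?c \<xi> - cis (2 * pi * h * \<xi>) * g \<xi>) = L2_norm (\<lambda>\<xi>. FT (cutoff R f) \<xi> - g \<xi>)"
        unfolding FTc right_diff_distrib[symmetric] by (simp add: L2_norm_def norm_mult)
      have "L2_norm (\<lambda>\<xi>. FT (cutoff R ?f) \<xi> - cis (2 * pi * h * \<xi>) * g \<xi>) \<le>
         L2_norm (\<lambda>\<xi>. FT (cutoff R ?f) \<xi> - FT ?c \<xi>) + L2_norm (\<lambda>\<xi>. FT ?c \<xi> - cis (2 * pi * h * \<xi>) * g \<xi>)"
        by (intro L2_norm_diff_triangle FT_cutoff_L2 fh eg g Plancherel_L1_L2 cint cL2)
      then show ?thesis using 1 2 by simp
    qed
    then show "eventually (\<lambda>R. L2_norm (\<lambda>\<xi>. FT (cutoff R ?f) \<xi> - cis (2 * pi * h * \<xi>) * g \<xi>)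
       \<le> L2_norm (\<lambda>x. cutoff R ?f x - ?f x) + L2_norm (\<lambda>x. cutoff R f x - f x)
        + L2_norm (\<lambda>\<xi>. FT (cutoff R f) \<xi> - g \<xi>)) at_top" by simp
  qed simp
  then show ?thesis using fh eg[OF g] by (simp add: is_L2_fourier_iff)
qed

section \<open>Sobolev spaces\<close>

abbreviation sobolev_weight :: "real \<Rightarrow> real \<Rightarrow> real" where
  "sobolev_weight s \<xi> \<equiv> (1 + \<bar>\<xi>\<bar>\<^sup>2) powr (s / 2)"

lemma sobolev_weight_ge_1: "0 \<le> s \<Longrightarrow> 1 \<le> sobolev_weight s \<xi>"
  by (intro ge_one_powr_ge_zero) auto

lemma sobolev_weighted_add: "sobolev_weighted s (\<lambda>x. f x + g x) = (\<lambda>x. sobolev_weighted s f x + sobolev_weighted s g x)"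
  by (simp add: sobolev_weighted_def distrib_left)

lemma sobolev_weighted_diff: "sobolev_weighted s (\<lambda>x. f x - g x) = (\<lambda>x. sobolev_weighted s f x - sobolev_weighted s g x)"
  by (simp add: sobolev_weighted_def right_diff_distrib)

lemma sobolev_weighted_scale: "sobolev_weighted s (\<lambda>x. c * f x) = (\<lambda>x. c * sobolev_weighted s f x)"
  by (simp add: sobolev_weighted_def mult.left_commute)

lemma sobolev_weighted_measurable [measurable]:
  assumes [measurable]: "g \<in> borel_measurable borel"
  shows "sobolev_weighted s g \<in> borel_measurable borel"
  unfolding sobolev_weighted_def by measurable

text \<open>\<open>sobolev_norm\<close> is defined through an arbitrary choice of transform; since
  any two transforms agree almost everywhere, each one computes the norm.\<close>

lemma sobolevE:
  assumes "f \<in> sobolev s"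
  obtains g where "f \<in> L2" "is_L2_fourier f g" "sobolev_weighted s g \<in> L2" "sobolev_norm s f = L2_norm (sobolev_weighted s g)"
proof -
  from assms obtain g where g: "f \<in> L2" "is_L2_fourier f g" "sobolev_weighted s g \<in> L2"
    by (auto simp: sobolev_def)
  have g': "is_L2_fourier f (L2_fourier f)"
    unfolding L2_fourier_def by (rule someI[of _ g]) (rule g(2))
  note [measurable] = L2_measurable[OF is_L2_fourier_mem[OF g']] L2_measurable[OF is_L2_fourier_mem[OF g(2)]]
  have "sobolev_norm s f = L2_norm (sobolev_weighted s g)"
    unfolding sobolev_norm_def
  proof (rule L2_norm_cong_AE)
    show "AE \<xi> in lborel. cmod (sobolev_weighted s (L2_fourier f) \<xi>) = cmod (sobolev_weighted s g \<xi>)"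
      using is_L2_fourier_unique[OF g(1) g' g(2)] by eventually_elim (simp add: sobolev_weighted_def)
  qed measurable
  with g show ?thesis by (rule that)
qed

lemma sobolevI:
  assumes "f \<in> L2" "is_L2_fourier f g" "sobolev_weighted s g \<in> L2"
  shows "f \<in> sobolev s" "sobolev_norm s f = L2_norm (sobolev_weighted s g)"
proof -
  show f: "f \<in> sobolev s" using assms by (auto simp: sobolev_def)
  obtain g' where g': "is_L2_fourier f g'" "sobolev_weighted s g' \<in> L2" "sobolev_norm s f = L2_norm (sobolev_weighted s g')"
    using sobolevE[OF f] by metis
  note g'(3)
  also have "L2_norm (sobolev_weighted s g') = L2_norm (sobolev_weighted s g)"
  proof (rule L2_norm_cong_AE)
    show "AE \<xi> in lborel. cmod (sobolev_weighted s g' \<xi>) = cmod (sobolev_weighted s g \<xi>)"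
      using is_L2_fourier_unique[OF assms(1) g'(1) assms(2)] by eventually_elim (simp add: sobolev_weighted_def)
  qed (use g' assms in \<open>auto simp: L2_measurable\<close>)
  finally show "sobolev_norm s f = L2_norm (sobolev_weighted s g)" .
qed

lemma sobolev_L2: "f \<in> sobolev s \<Longrightarrow> f \<in> L2"
  by (simp add: sobolev_def)

interpretation sobolev: function_seminorm "sobolev s" "sobolev_norm s" for s
proof
  have F0: "is_L2_fourier (\<lambda>x. 0) (\<lambda>x. 0)"
    by (subst is_L2_fourier_iff) (auto simp: cutoff_def FT_def)
  show "(\<lambda>x. 0) \<in> sobolev s"
    by (rule sobolevI[OF L2_zero F0]) (simp add: sobolev_weighted_def L2_zero)
next
  fix f1 f2 assume f: "f1 \<in> sobolev s" "f2 \<in> sobolev s"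
  obtain g1 where g1: "f1 \<in> L2" "is_L2_fourier f1 g1" "sobolev_weighted s g1 \<in> L2" "sobolev_norm s f1 = L2_norm (sobolev_weighted s g1)"
    using f(1) by (rule sobolevE)
  obtain g2 where g2: "f2 \<in> L2" "is_L2_fourier f2 g2" "sobolev_weighted s g2 \<in> L2" "sobolev_norm s f2 = L2_norm (sobolev_weighted s g2)"
    using f(2) by (rule sobolevE)
  have w: "sobolev_weighted s (\<lambda>x. g1 x + g2 x) \<in> L2"
    unfolding sobolev_weighted_add by (intro L2_add g1 g2)
  note 1 = sobolevI[OF L2_add[OF g1(1) g2(1)] is_L2_fourier_add[OF g1(1) g2(1) g1(2) g2(2)] w]
  show "(\<lambda>x. f1 x + f2 x) \<in> sobolev s" by (rule 1(1))
  show "sobolev_norm s (\<lambda>x. f1 x + f2 x) \<le> sobolev_norm s f1 + sobolev_norm s f2"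
    unfolding 1(2) g1(4) g2(4) sobolev_weighted_add by (intro L2_norm_triangle g1 g2)
next
  fix f c assume f: "f \<in> sobolev s"
  obtain g where g: "f \<in> L2" "is_L2_fourier f g" "sobolev_weighted s g \<in> L2" "sobolev_norm s f = L2_norm (sobolev_weighted s g)"
    using f by (rule sobolevE)
  have w: "sobolev_weighted s (\<lambda>x. c * g x) \<in> L2"
    unfolding sobolev_weighted_scale by (intro L2_scale g)
  note 1 = sobolevI[OF L2_scale[OF g(1)] is_L2_fourier_scale[OF g(1,2)] w]
  show "(\<lambda>x. c * f x) \<in> sobolev s" by (rule 1(1))
  show "sobolev_norm s (\<lambda>x. c * f x) = cmod c * sobolev_norm s f"
    unfolding 1(2) g(4) sobolev_weighted_scale by (rule L2_norm_scale)
qed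

lemma L2_norm_le_weighted:
  assumes "0 \<le> s" "g \<in> borel_measurable borel" "sobolev_weighted s g \<in> L2"
  shows "g \<in> L2" "L2_norm g \<le> L2_norm (sobolev_weighted s g)"
proof -
  have le: "AE x in lborel. cmod (g x) \<le> 1 * cmod (sobolev_weighted s g x)"
    using mult_right_mono[OF sobolev_weight_ge_1[OF assms(1)] norm_ge_zero[of "g _"]]
    by (simp add: sobolev_weighted_def norm_mult)
  show "g \<in> L2" "L2_norm g \<le> L2_norm (sobolev_weighted s g)"
    using L2_bound[OF assms(3,2) le] by auto
qed

lemma L2_norm_le_sobolev_norm:
  assumes "0 \<le> s" "f \<in> sobolev s" shows "L2_norm f \<le> sobolev_norm s f"
proof -
  obtain g where g: "f \<in> L2" "is_L2_fourier f g" "sobolev_weighted s g \<in> L2" "sobolev_norm s f = L2_norm (sobolev_weighted s g)"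
    using assms(2) by (rule sobolevE)
  show ?thesis
    using L2_norm_le_weighted(2)[OF assms(1) L2_measurable[OF is_L2_fourier_mem[OF g(2)]] g(3)]
    by (simp add: g(4) is_L2_fourier_norm[OF g(1,2)])
qed

text \<open>The weighted transforms converge in L2 to some G, and the functions themselves converge
  in L2 to some u. Closedness of the transform identifies G divided by the weight as the transform
  of u, so u need not be recovered from G by inversion.\<close>

lemma sobolev_complete:
  assumes s: "0 \<le> s" and f: "\<And>n. f n \<in> sobolev s"
    and step: "\<And>n. sobolev_norm s (\<lambda>x. f (Suc n) x - f n x) \<le> c * (1/4) ^ n"
  shows "\<exists>u\<in>sobolev s. (\<lambda>n. sobolev_norm s (\<lambda>x. f n x - u x)) \<longlonglongrightarrow> 0"
proof -
  have "\<forall>n. \<exists>g. is_L2_fourier (f n) g \<and> sobolev_weighted s g \<in> L2"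
    using f by (auto simp: sobolev_def)
  then obtain g where F: "\<And>n. is_L2_fourier (f n) (g n)" and w: "\<And>n. sobolev_weighted s (g n) \<in> L2"
    by metis
  note fL2 = sobolev_L2[OF f]
  have norm_diff: "sobolev_norm s (\<lambda>x. f n x - f m x) = L2_norm (\<lambda>x. sobolev_weighted s (g n) x - sobolev_weighted s (g m) x)" for n m
    using sobolevI(2)[OF L2_diff[OF fL2 fL2] is_L2_fourier_diff[OF fL2 fL2 F F], of s n m] w
    by (simp add: sobolev_weighted_diff L2_diff)
  obtain G where G: "G \<in> L2" and limG: "(\<lambda>n. L2_norm (\<lambda>x. sobolev_weighted s (g n) x - G x)) \<longlonglongrightarrow> 0"
    using L2_complete[of "\<lambda>n. sobolev_weighted s (g n)" c] w step unfolding norm_diff by blast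
  have "L2_norm (\<lambda>x. f (Suc n) x - f n x) \<le> c * (1/4) ^ n" for n
    using order_trans[OF L2_norm_le_sobolev_norm[OF s sobolev.diff_mem[OF f f]] step] .
  then obtain u where u: "u \<in> L2" and limu: "(\<lambda>n. L2_norm (\<lambda>x. f n x - u x)) \<longlonglongrightarrow> 0"
    using L2_complete[of f c] fL2 by blast
  define h where "h \<xi> = G \<xi> / complex_of_real (sobolev_weight s \<xi>)" for \<xi>
  have W: "sobolev_weight s \<xi> \<noteq> 0" for \<xi> using sobolev_weight_ge_1[OF s, of \<xi>] by linarith
  have wh: "sobolev_weighted s h = G"
    by (rule ext) (use W in \<open>simp add: h_def sobolev_weighted_def\<close>)
  note [measurable] = L2_measurable[OF G]
  have [measurable]: "h \<in> borel_measurable borel" unfolding h_def[abs_def] by measurable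
  have hL2: "h \<in> L2" by (rule L2_norm_le_weighted(1)[OF s, of h]) (simp_all add: wh G)
  have "(\<lambda>n. L2_norm (\<lambda>x. g n x - h x)) \<longlonglongrightarrow> 0"
  proof (rule tendsto_sandwich[OF _ _ tendsto_const limG])
    have "L2_norm (\<lambda>x. g n x - h x) \<le> L2_norm (\<lambda>x. sobolev_weighted s (g n) x - G x)" for n
      using L2_norm_le_weighted(2)[OF s, of "\<lambda>x. g n x - h x"] is_L2_fourier_mem[OF F, of n] w[of n] G hL2
      unfolding sobolev_weighted_diff wh by (simp add: L2_diff L2_measurable)
    then show "eventually (\<lambda>n. L2_norm (\<lambda>x. g n x - h x) \<le> L2_norm (\<lambda>x. sobolev_weighted s (g n) x - G x)) sequentially"
      by simp
  qed simp
  then have Fu: "is_L2_fourier u h"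
    by (rule is_L2_fourier_limit[OF fL2 u limu F hL2])
  have "u \<in> sobolev s" using sobolevI(1)[OF u Fu] wh G by simp
  moreover have "sobolev_norm s (\<lambda>x. f n x - u x) = L2_norm (\<lambda>x. sobolev_weighted s (g n) x - G x)" for n
    using sobolevI(2)[OF L2_diff[OF fL2 u] is_L2_fourier_diff[OF fL2 u F Fu], of s n] w[of n] G
    by (simp add: sobolev_weighted_diff L2_diff wh)
  ultimately show ?thesis using limG by (intro bexI[of _ u]) simp_all
qed

section \<open>Translations of Sobolev functions\<close>

lemma norm_cis_minus_1_le: "cmod (cis t - 1) \<le> \<bar>t\<bar>"
  using iexp_approx1[of t 0] by (simp add: cis_conv_exp)

text \<open>Translation by h multiplies the transform by cis(2 pi h xi). The factor cis(2 pi h xi) -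
  1 is at most \<eta> times the weight: at high frequency because the weight is large, at low
  frequency because h is small.\<close>

lemma sobolev_translation_small:
  assumes s: "0 < s" and \<eta>: "0 < \<eta>"
  shows "\<exists>\<delta>>0. \<forall>h f. \<bar>h\<bar> \<le> \<delta> \<longrightarrow> f \<in> sobolev s \<longrightarrow> L2_norm (\<lambda>x. f (x + h) - f x) \<le> \<eta> * sobolev_norm s f"
proof -
  \<comment> \<open>Chosen so that L^s = 2/\<eta>: beyond L the trivial bound 2 is absorbed by the
    weight.\<close>
  define L where "L = (2 / \<eta>) powr (1 / s)"
  have L: "0 < L" using \<eta> by (simp add: L_def)
  have big: "2 \<le> \<eta> * sobolev_weight s \<xi>" if "L \<le> \<bar>\<xi>\<bar>" for \<xi>
  proof -
    have "2 / \<eta> = L powr s" using s \<eta> by (simp add: L_def powr_powr)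
    also have "\<dots> = (L\<^sup>2) powr (s / 2)" using L by (simp add: powr_powr flip: powr_numeral)
    also have "\<dots> \<le> sobolev_weight s \<xi>"
      using that L s power_mono[of L "\<bar>\<xi>\<bar>" 2] by (intro powr_mono2) auto
    finally show ?thesis using \<eta> by (simp add: field_simps)
  qed
  \<comment> \<open>Then 2 pi |h xi| is at most \<eta> for |h| at most \<delta> and |xi| below
    L.\<close>
  define \<delta> where "\<delta> = \<eta> / (2 * pi * L)"
  have \<delta>: "0 < \<delta>" using \<eta> L by (simp add: \<delta>_def)
  have "L2_norm (\<lambda>x. f (x + h) - f x) \<le> \<eta> * sobolev_norm s f" if h: "\<bar>h\<bar> \<le> \<delta>" and f: "f \<in> sobolev s" for h f
  proof -
    obtain g where g: "f \<in> L2" "is_L2_fourier f g" "sobolev_weighted s g \<in> L2" "sobolev_norm s f = L2_norm (sobolev_weighted s g)"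
      using f by (rule sobolevE)
    note [measurable] = L2_measurable[OF is_L2_fourier_mem[OF g(2)]]
    have key: "cmod (cis (2 * pi * h * \<xi>) - 1) \<le> \<eta> * sobolev_weight s \<xi>" for \<xi>
    proof (cases "L \<le> \<bar>\<xi>\<bar>")
      case True
      have "cmod (cis (2 * pi * h * \<xi>) - 1) \<le> 2"
        using norm_triangle_ineq4[of "cis (2 * pi * h * \<xi>)" 1] by simp
      then show ?thesis using big[OF True] by simp
    next
      case False
      have "cmod (cis (2 * pi * h * \<xi>) - 1) \<le> 2 * pi * (\<bar>h\<bar> * \<bar>\<xi>\<bar>)"
        using norm_cis_minus_1_le[of "2 * pi * h * \<xi>"] by (simp add: abs_mult mult.assoc)
      also have "\<dots> \<le> 2 * pi * (\<delta> * L)"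
        using False h \<delta> by (intro mult_left_mono mult_mono) auto
      also have "\<dots> = \<eta> * 1" using L by (simp add: \<delta>_def)
      also have "\<dots> \<le> \<eta> * sobolev_weight s \<xi>"
        using \<eta> s by (intro mult_left_mono sobolev_weight_ge_1) auto
      finally show ?thesis .
    qed
    have "L2_norm (\<lambda>x. f (x + h) - f x) = L2_norm (\<lambda>\<xi>. cis (2 * pi * h * \<xi>) * g \<xi> - g \<xi>)"
      using is_L2_fourier_norm[OF L2_diff[OF L2_translate(1)[OF g(1)] g(1)]
        is_L2_fourier_diff[OF L2_translate(1)[OF g(1)] g(1) is_L2_fourier_translate[OF g(1,2)] g(2)], of h] by simp
    also have "\<dots> \<le> \<eta> * L2_norm (sobolev_weighted s g)"
    proof (rule L2_bound(2)[OF g(3)])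
      have "cmod (cis (2 * pi * h * \<xi>) * g \<xi> - g \<xi>) \<le> \<eta> * cmod (sobolev_weighted s g \<xi>)" for \<xi>
      proof -
        have "cmod (cis (2 * pi * h * \<xi>) * g \<xi> - g \<xi>) = cmod (cis (2 * pi * h * \<xi>) - 1) * cmod (g \<xi>)"
          by (simp add: left_diff_distrib flip: norm_mult)
        also have "\<dots> \<le> \<eta> * sobolev_weight s \<xi> * cmod (g \<xi>)" by (intro mult_right_mono key) simp
        finally show ?thesis by (simp add: sobolev_weighted_def norm_mult mult.assoc)
      qed
      then show "AE \<xi> in lborel. cmod (cis (2 * pi * h * \<xi>) * g \<xi> - g \<xi>) \<le> \<eta> * cmod (sobolev_weighted s g \<xi>)" by simp
    qed (use \<eta> in auto)
    finally show ?thesis by (simp add: g(4))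
  qed
  with \<delta> show ?thesis by blast
qed

section \<open>The uniform boundedness principle\<close>

context function_seminorm
begin

text \<open>
  Sokal's gliding hump argument, which needs completeness only for geometrically Cauchy sequences
  and no Baire category.
\<close>

lemma uniform_boundedness:
  fixes T :: "nat \<Rightarrow> ('a \<Rightarrow> complex) \<Rightarrow> ('a \<Rightarrow> complex)"
  assumes complete: "\<And>f c. (\<And>n. f n \<in> X) \<Longrightarrow> (\<And>n. p (\<lambda>x. f (Suc n) x - f n x) \<le> c * (1/4) ^ n) \<Longrightarrow>
      \<exists>u\<in>X. (\<lambda>n. p (\<lambda>x. f n x - u x)) \<longlonglongrightarrow> 0"
    and T_mem: "\<And>n f. f \<in> X \<Longrightarrow> T n f \<in> X"
    and T_diff: "\<And>n f g. f \<in> X \<Longrightarrow> g \<in> X \<Longrightarrow> T n (\<lambda>x. f x - g x) = (\<lambda>x. T n f x - T n g x)"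
    and T_scale: "\<And>n f c. f \<in> X \<Longrightarrow> T n (\<lambda>x. c * f x) = (\<lambda>x. c * T n f x)"
    and T_bounded: "\<And>n. \<exists>B. \<forall>f\<in>X. p (T n f) \<le> B * p f"
    and pointwise: "\<And>f. f \<in> X \<Longrightarrow> \<exists>M. \<forall>n. p (T n f) \<le> M"
  shows "\<exists>C. \<forall>n. \<forall>f\<in>X. p (T n f) \<le> C * p f"
proof (rule ccontr)
  assume unbdd: "\<not> ?thesis"
  define S where "S n = (\<lambda>f. p (T n f)) ` {f \<in> X. p f \<le> 1}" for n
  \<comment> \<open>The operator norm of \<open>T n\<close>.\<close>
  define N where "N n = Sup (S n)" for n
  have S_bdd: "bdd_above (S n)" for n
  proof -
    obtain B where B: "\<And>f. f \<in> X \<Longrightarrow> p (T n f) \<le> B * p f" using T_bounded by blast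
    have "p (T n f) \<le> \<bar>B\<bar>" if "f \<in> X" "p f \<le> 1" for f
    proof -
      have "p (T n f) \<le> \<bar>B\<bar> * p f"
        using B[OF that(1)] mult_right_mono[OF abs_ge_self nonneg[OF that(1)], of B] by simp
      also have "\<dots> \<le> \<bar>B\<bar> * 1" using that by (intro mult_left_mono) auto
      finally show ?thesis by simp
    qed
    then show ?thesis unfolding S_def by (auto intro!: bdd_aboveI2)
  qed
  have S_ne: "S n \<noteq> {}" for n
    unfolding S_def using zero_mem p_zero by force
  \<comment> \<open>A function with p f = 0 cannot be normalised; boundedness of the single operator
    \<open>T n\<close> handles it.\<close>
  have N_le: "p (T n f) \<le> N n * p f" if f: "f \<in> X" for n f
  proof (cases "p f = 0")
    case True
    obtain B where "p (T n f) \<le> B * p f" using T_bounded f by blast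
    then show ?thesis using True by simp
  next
    case False
    then have pos: "0 < p f" using nonneg[OF f] by simp
    let ?c = "complex_of_real (1 / p f)"
    have "p (T n (\<lambda>x. ?c * f x)) \<in> S n"
      unfolding S_def using pos f by (intro imageI) (simp add: scale_mem scale del: of_real_divide)
    then have "p (T n (\<lambda>x. ?c * f x)) \<le> N n" unfolding N_def by (intro cSup_upper S_bdd)
    moreover have "p (T n (\<lambda>x. ?c * f x)) = p (T n f) / p f"
      unfolding T_scale[OF f] scale[OF T_mem[OF f]] using pos by (simp add: norm_divide)
    ultimately have "p (T n f) / p f \<le> N n" by simp
    then show ?thesis using pos by (simp add: divide_le_eq)
  qed
  \<comment> \<open>Growth like 16^k outweighs the step size 4^-k and still leaves 4^k.\<close>
  have "\<exists>n. 16 ^ k < N n" for k :: nat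
  proof (rule ccontr)
    assume "\<not> ?thesis"
    then have N: "N n \<le> 16 ^ k" for n by (simp add: not_less)
    have "p (T n f) \<le> 16 ^ k * p f" if "f \<in> X" for n f
      using order_trans[OF N_le[OF that] mult_right_mono[OF N nonneg[OF that]]] .
    then show False using unbdd by blast
  qed
  then obtain m where m: "\<And>k::nat. 16 ^ k < N (m k)" by metis
  \<comment> \<open>Take z of size at most 4^-k on which \<open>T (m k)\<close> nearly attains its
    norm. As 2 z = (x + z) - (x - z), one of the points x + z and x - z has an image at least as
    large as that of z, whatever x is.\<close>
  have hump: "\<exists>y. y \<in> X \<and> p (\<lambda>t. y t - x t) \<le> (1/4) ^ k \<and> (1/4) ^ k * N (m k) / 2 \<le> p (T (m k) y)"
    if x: "x \<in> X" for x k
  proof -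
    have "(0::real) < 16 ^ k" by simp
    with m[of k] have "N (m k) / 2 < N (m k)" by linarith
    then have "N (m k) / 2 < Sup (S (m k))" unfolding N_def .
    then obtain y where "y \<in> S (m k)" "N (m k) / 2 < y"
      using S_ne[of "m k"] by (rule less_cSupE)
    then obtain \<xi> where \<xi>: "\<xi> \<in> X" "p \<xi> \<le> 1" "N (m k) / 2 < p (T (m k) \<xi>)"
      unfolding S_def by blast
    define z where "z t = complex_of_real ((1/4) ^ k) * \<xi> t" for t
    have z: "z \<in> X" unfolding z_def by (rule scale_mem[OF \<xi>(1)])
    have pz: "p z \<le> (1/4) ^ k"
      unfolding z_def scale[OF \<xi>(1)] using \<xi>(2) by (simp add: norm_power mult_le_cancel_left1 del: of_real_power)
    have Tz: "(1/4) ^ k * N (m k) / 2 \<le> p (T (m k) z)"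
    proof -
      have "p (T (m k) z) = (1/4) ^ k * p (T (m k) \<xi>)"
        unfolding z_def T_scale[OF \<xi>(1)] scale[OF T_mem[OF \<xi>(1)]] by (simp add: norm_power del: of_real_power)
      moreover have "(1/4) ^ k * (N (m k) / 2) \<le> (1/4) ^ k * p (T (m k) \<xi>)"
        using \<xi>(3) by (intro mult_left_mono) auto
      ultimately show ?thesis by simp
    qed
    let ?a = "\<lambda>t. x t + z t" and ?b = "\<lambda>t. x t - z t"
    have ab: "?a \<in> X" "?b \<in> X" using x z by (auto intro: add_mem diff_mem)
    have "2 * p (T (m k) z) = p (T (m k) (\<lambda>t. 2 * z t))"
      unfolding T_scale[OF z] scale[OF T_mem[OF z]] by simp
    also have "(\<lambda>t. 2 * z t) = (\<lambda>t. ?a t - ?b t)" by auto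
    also have "p (T (m k) \<dots>) \<le> p (T (m k) ?a) + p (T (m k) ?b)"
      unfolding T_diff[OF ab] using triangle[OF T_mem[OF ab(1)] scale_mem[OF T_mem[OF ab(2)]], of "m k" "-1" "m k"]
        scale[OF T_mem[OF ab(2)], of "-1" "m k"] by simp
    finally have "(1/4) ^ k * N (m k) / 2 \<le> p (T (m k) ?a) \<or> (1/4) ^ k * N (m k) / 2 \<le> p (T (m k) ?b)"
      using Tz by linarith
    moreover have "p (\<lambda>t. ?a t - x t) \<le> (1/4) ^ k" "p (\<lambda>t. ?b t - x t) \<le> (1/4) ^ k"
      using pz scale[OF z, of "-1"] by simp_all
    ultimately show ?thesis using ab by blast
  qed
  have "\<exists>f. \<forall>k. (f k \<in> X \<and> (1/4) ^ k * N (m k) / 2 \<le> p (T (m k) (f k))) \<and>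
      p (\<lambda>t. f (Suc k) t - f k t) \<le> (1/4) ^ Suc k"
  proof (rule dependent_nat_choice[where P="\<lambda>k x. x \<in> X \<and> (1/4) ^ k * N (m k) / 2 \<le> p (T (m k) x)"
        and Q="\<lambda>k x y. p (\<lambda>t. y t - x t) \<le> (1/4) ^ Suc k"])
    show "\<exists>x. x \<in> X \<and> (1/4) ^ 0 * N (m 0) / 2 \<le> p (T (m 0) x)"
      using hump[OF zero_mem, of 0] by blast
    show "\<exists>y. (y \<in> X \<and> (1/4) ^ Suc k * N (m (Suc k)) / 2 \<le> p (T (m (Suc k)) y)) \<and>
        p (\<lambda>t. y t - x t) \<le> (1/4) ^ Suc k"
      if "x \<in> X \<and> (1/4) ^ k * N (m k) / 2 \<le> p (T (m k) x)" for x k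
      using that hump[of x "Suc k"] by blast
  qed
  then obtain f where f: "\<And>k. f k \<in> X" and big: "\<And>k. (1/4) ^ k * N (m k) / 2 \<le> p (T (m k) (f k))"
    and step: "\<And>k. p (\<lambda>t. f (Suc k) t - f k t) \<le> 1/4 * (1/4) ^ k"
    by auto
  obtain u where u: "u \<in> X" and lim: "(\<lambda>n. p (\<lambda>x. f n x - u x)) \<longlonglongrightarrow> 0"
    using complete[OF f step] by blast
  \<comment> \<open>All steps after the k-th together: 4^-(k+1) * 4/3.\<close>
  have close: "p (\<lambda>x. f k x - u x) \<le> (1/4) ^ k / 3" for k
  proof (rule LIMSEQ_le_const)
    show "(\<lambda>j. (1/4) ^ k / 3 + p (\<lambda>x. f (k + j) x - u x)) \<longlonglongrightarrow> (1/4) ^ k / 3"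
      using tendsto_add[OF tendsto_const LIMSEQ_ignore_initial_segment[OF lim, of k], of "(1/4) ^ k / 3"]
      by (simp add: add.commute[of k])
    have "p (\<lambda>x. f k x - u x) \<le> (1/4) ^ k / 3 + p (\<lambda>x. f (k + j) x - u x)" for j
      using diff_triangle[OF f f u, of k "k + j"] geometric_dist[OF f step, of k j] minus_commute[OF f f, of k "k + j"] by simp
    then show "\<exists>N. \<forall>j\<ge>N. p (\<lambda>x. f k x - u x) \<le> (1/4) ^ k / 3 + p (\<lambda>x. f (k + j) x - u x)" by blast
  qed
  obtain M where M: "\<And>n. p (T n u) \<le> M" using pointwise[OF u] by blast
  \<comment> \<open>The image of f k is at least half of 4^-k N, and moving on to u loses at most a
    third; the remaining sixth is bounded by M although N exceeds 16^k.\<close>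
  have "4 ^ k \<le> 6 * M" for k :: nat
  proof -
    have "p (T (m k) (f k)) \<le> p (T (m k) (\<lambda>x. f k x - u x)) + p (T (m k) u)"
      unfolding T_diff[OF f u] using triangle[OF diff_mem[OF T_mem[OF f] T_mem[OF u]] T_mem[OF u], of "m k" k "m k" "m k"] by simp
    also have "p (T (m k) (\<lambda>x. f k x - u x)) \<le> N (m k) * ((1/4) ^ k / 3)"
      using order_trans[OF N_le[OF diff_mem[OF f u]] mult_left_mono[OF close]] m[of k]
      by (meson less_imp_le less_trans zero_less_power zero_less_numeral)
    finally have "(1/4) ^ k * N (m k) / 2 \<le> N (m k) * ((1/4) ^ k / 3) + M"
      using big[of k] M[of "m k"] by linarith
    then have "(1/4) ^ k * N (m k) / 6 \<le> M" by (simp add: field_simps)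
    moreover have "(1/4) ^ k * 16 ^ k \<le> (1/4) ^ k * N (m k)"
      using m[of k] by (intro mult_left_mono) auto
    moreover have "(1/4) ^ k * 16 ^ k = (4::real) ^ k" by (simp flip: power_mult_distrib)
    ultimately show ?thesis by linarith
  qed
  moreover obtain k :: nat where "6 * M < 4 ^ k" using real_arch_pow[of 4 "6 * M"] by auto
  ultimately show False by (meson not_less)
qed

end

section \<open>Local compactness\<close>

text \<open>The mean over [x, x + d], written over the fixed interval [0, d] so that its difference
  from f x is a mean of translation differences.\<close>

definition average :: "real \<Rightarrow> (real \<Rightarrow> complex) \<Rightarrow> real \<Rightarrow> complex" where
  "average d f x = (LINT t|lborel. f (x + t) * indicator {0..d} t) / complex_of_real d"

lemma average_measurable [measurable]:
  assumes [measurable]: "f \<in> borel_measurable borel"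
  shows "average d f \<in> borel_measurable borel"
  unfolding average_def[abs_def] by measurable

lemma indicator_Icc_L2: "(\<lambda>t. indicator {a..b} t) \<in> L2"
  by (rule L2_bounded_support[of _ 1 a b]) (auto split: split_indicator)

lemma L2_norm_indicator_Icc: "a \<le> b \<Longrightarrow> L2_norm (\<lambda>t. indicator {a..b} t) = sqrt (b - a)"
proof -
  assume "a \<le> b"
  have "(LINT t|lborel. (cmod (indicator {a..b} t))\<^sup>2) = (LINT t|lborel. indicator {a..b} t)"
    by (intro Bochner_Integration.integral_cong) (auto split: split_indicator)
  then show ?thesis using \<open>a \<le> b\<close> by (simp add: L2_norm_def)
qed

text \<open>In this form weak convergence in L2 gives pointwise convergence of averages, and
  Cauchy-Schwarz bounds them uniformly in x.\<close>

lemma average_eq_inner: "average d f x = L2_inner f (\<lambda>t. indicator {x..x + d} t) / complex_of_real d"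
proof -
  have "L2_inner f (\<lambda>t. indicator {x..x + d} t) = (LINT t|lborel. f (x + t) * cnj (indicator {x..x + d} (x + t)))"
    unfolding L2_inner_def
    using lborel_integral_real_affine[of 1 "\<lambda>t. f t * cnj (indicator {x..x + d} t)" x] by simp
  also have "\<dots> = (LINT t|lborel. f (x + t) * indicator {0..d} t)"
    by (intro Bochner_Integration.integral_cong) (auto split: split_indicator)
  finally show ?thesis by (simp add: average_def)
qed

lemma average_bound:
  assumes f: "f \<in> L2" and d: "0 < d"
  shows "cmod (average d f x) \<le> L2_norm f / sqrt d"
proof -
  have "cmod (average d f x) \<le> L2_norm f * sqrt d / d"
    using L2_inner_bound[OF f indicator_Icc_L2, of x "x + d"] d
    by (simp add: average_eq_inner norm_divide L2_norm_indicator_Icc divide_right_mono)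
  also have "\<dots> = L2_norm f / sqrt d"
    using d real_sqrt_mult_self[of d] by (simp add: field_simps)
  finally show ?thesis .
qed

text \<open>Jensen's inequality for the uniform distribution on [0, d], here as Cauchy-Schwarz
  against the indicator. The extended integral prepares for Tonelli in x and t.\<close>

lemma average_diff_pointwise:
  assumes f: "f \<in> L2" and d: "0 < d"
  shows "ennreal ((cmod (average d f x - f x))\<^sup>2)
     \<le> ennreal (1 / d) * (\<integral>\<^sup>+t. indicator {0..d} t * ennreal ((cmod (f (x + t) - f x))\<^sup>2) \<partial>lborel)"
proof -
  note [measurable] = L2_measurable[OF f]
  define u where "u t = f (x + t) * indicator {0..d} t - f x * indicator {0..d} t" for t
  have fx: "(\<lambda>t. f (x + t)) \<in> L2" using L2_translate(1)[OF f, of x] by (simp add: add.commute)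
  have 1: "(\<lambda>t. f (x + t) * indicator {0..d} t) \<in> L2"
    by (rule L2_bound(1)[OF fx, where c=1]) (auto split: split_indicator)
  have 2: "(\<lambda>t. f x * indicator {0..d} t) \<in> L2" by (rule L2_scale[OF indicator_Icc_L2])
  have uL2: "u \<in> L2" unfolding u_def by (rule L2_diff[OF 1 2])
  note ind = indicator_Icc_L2[of 0 d]
  have "L2_inner u (\<lambda>t. indicator {0..d} t) 
     = L2_inner (\<lambda>t. f (x + t) * indicator {0..d} t) (\<lambda>t. indicator {0..d} t) - L2_inner (\<lambda>t. f x * indicator {0..d} t) (\<lambda>t. indicator {0..d} t)"
    unfolding u_def by (rule L2_inner_diff_left[OF 1 2 ind])
  also have "L2_inner (\<lambda>t. f (x + t) * indicator {0..d} t) (\<lambda>t. indicator {0..d} t) = complex_of_real d * average d f x"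
  proof -
    have "L2_inner (\<lambda>t. f (x + t) * indicator {0..d} t) (\<lambda>t. indicator {0..d} t) = (LINT t|lborel. f (x + t) * indicator {0..d} t)"
      unfolding L2_inner_def by (intro Bochner_Integration.integral_cong) (auto split: split_indicator)
    then show ?thesis using d by (simp add: average_def)
  qed
  also have "L2_inner (\<lambda>t. f x * indicator {0..d} t) (\<lambda>t. indicator {0..d} t) = complex_of_real d * f x"
    unfolding L2_inner_scale_left L2_inner_self L2_norm_indicator_Icc[OF less_imp_le[OF d]] using d by simp
  finally have eq: "L2_inner u (\<lambda>t. indicator {0..d} t) = complex_of_real d * (average d f x - f x)"
    by (simp add: right_diff_distrib)
  have "d * cmod (average d f x - f x) \<le> L2_norm u * sqrt d"
    using L2_inner_bound[OF uL2 ind] d unfolding eq by (simp add: norm_mult L2_norm_indicator_Icc)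
  then have "(d * cmod (average d f x - f x))\<^sup>2 \<le> (L2_norm u * sqrt d)\<^sup>2"
    using d by (intro power_mono) auto
  then have "d * (d * (cmod (average d f x - f x))\<^sup>2) \<le> d * (L2_norm u)\<^sup>2"
    using d by (simp add: power_mult_distrib power2_eq_square[of d] mult_ac)
  then have "(cmod (average d f x - f x))\<^sup>2 \<le> 1 / d * (L2_norm u)\<^sup>2"
    using d by (simp add: field_simps)
  then have "ennreal ((cmod (average d f x - f x))\<^sup>2) \<le> ennreal (1 / d) * ennreal ((L2_norm u)\<^sup>2)"
    using d by (simp add: ennreal_leI flip: ennreal_mult)
  also have "ennreal ((L2_norm u)\<^sup>2) = (\<integral>\<^sup>+t. indicator {0..d} t * ennreal ((cmod (f (x + t) - f x))\<^sup>2) \<partial>lborel)"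
    unfolding nn_integral_L2[OF uL2, symmetric]
    by (intro nn_integral_cong) (auto simp: u_def split: split_indicator)
  finally show ?thesis .
qed

text \<open>Exchanging the integrals turns the squared distance into a mean over t of squared
  translation differences, each at most c^2.\<close>

lemma L2_norm_average_diff:
  assumes f: "f \<in> L2" and d: "0 < d" and c: "0 \<le> c"
    and small: "\<And>t. t \<in> {0..d} \<Longrightarrow> L2_norm (\<lambda>x. f (x + t) - f x) \<le> c"
  shows "(\<lambda>x. average d f x - f x) \<in> L2" "L2_norm (\<lambda>x. average d f x - f x) \<le> c"
proof -
  note [measurable] = L2_measurable[OF f]
  have "(\<integral>\<^sup>+x. ennreal ((cmod (average d f x - f x))\<^sup>2) \<partial>lborel)
     \<le> (\<integral>\<^sup>+x. ennreal (1 / d) * (\<integral>\<^sup>+t. indicator {0..d} t * ennreal ((cmod (f (x + t) - f x))\<^sup>2) \<partial>lborel) \<partial>lborel)"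
    by (intro nn_integral_mono average_diff_pointwise f d)
  also have "\<dots> = ennreal (1 / d) * (\<integral>\<^sup>+x. (\<integral>\<^sup>+t. indicator {0..d} t * ennreal ((cmod (f (x + t) - f x))\<^sup>2) \<partial>lborel) \<partial>lborel)"
    by (rule nn_integral_cmult) measurable
  also have "(\<integral>\<^sup>+x. (\<integral>\<^sup>+t. indicator {0..d} t * ennreal ((cmod (f (x + t) - f x))\<^sup>2) \<partial>lborel) \<partial>lborel)
     = (\<integral>\<^sup>+t. (\<integral>\<^sup>+x. indicator {0..d} t * ennreal ((cmod (f (x + t) - f x))\<^sup>2) \<partial>lborel) \<partial>lborel)"
    by (rule lborel_pair.Fubini') measurable
  also have "\<dots> \<le> (\<integral>\<^sup>+t. ennreal (c\<^sup>2) * indicator {0..d} t \<partial>lborel)"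
  proof (rule nn_integral_mono)
    fix t
    have "(\<integral>\<^sup>+x. ennreal ((cmod (f (x + t) - f x))\<^sup>2) \<partial>lborel) = ennreal ((L2_norm (\<lambda>x. f (x + t) - f x))\<^sup>2)"
      by (rule nn_integral_L2[OF L2_diff[OF L2_translate(1)[OF f] f]])
    then show "(\<integral>\<^sup>+x. indicator {0..d} t * ennreal ((cmod (f (x + t) - f x))\<^sup>2) \<partial>lborel) \<le> ennreal (c\<^sup>2) * indicator {0..d} t"
      using small[of t] by (auto split: split_indicator intro!: ennreal_leI power_mono)
  qed
  also have "\<dots> = ennreal (c\<^sup>2) * ennreal d"
    using d by (simp add: nn_integral_cmult_indicator)
  also have "ennreal (1 / d) * \<dots> = ennreal (c\<^sup>2)"
    using d by (simp flip: ennreal_mult)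
  finally have le: "(\<integral>\<^sup>+x. ennreal ((cmod (average d f x - f x))\<^sup>2) \<partial>lborel) \<le> ennreal (c\<^sup>2)"
    by (simp add: mult_left_mono)
  show "(\<lambda>x. average d f x - f x) \<in> L2" "L2_norm (\<lambda>x. average d f x - f x) \<le> c"
    by (rule L2I_nn_integral_le[OF _ le c]; measurable)+
qed

text \<open>Rellich's theorem for weakly null sequences. The length d is fixed first, by the H^s
  bound and uniformly in n; only then does n tend to infinity.\<close>

lemma weakly_null_cutoff_tendsto_0:
  assumes s: "0 < s" and g: "\<And>n. g n \<in> sobolev s" and bd: "\<And>n. sobolev_norm s (g n) \<le> C"
    and weak: "\<And>h. h \<in> L2 \<Longrightarrow> (\<lambda>n. L2_inner (g n) h) \<longlonglongrightarrow> 0"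
  shows "(\<lambda>n. L2_norm (cutoff A (g n))) \<longlonglongrightarrow> 0"
proof (rule LIMSEQ_I)
  fix \<epsilon> :: real assume e: "0 < \<epsilon>"
  note gL2 = sobolev_L2[OF g]
  note [measurable] = L2_measurable[OF gL2]
  have C: "0 \<le> C" using order_trans[OF sobolev.nonneg[OF g] bd] .
  have gC: "L2_norm (g n) \<le> C" for n
    using order_trans[OF L2_norm_le_sobolev_norm[OF less_imp_le[OF s] g] bd] .
  \<comment> \<open>Makes \<eta> C at most \<epsilon>/2; the summand 1 avoids division by 0 when C =
    0.\<close>
  define \<eta> where "\<eta> = \<epsilon> / (2 * (C + 1))"
  have \<eta>: "0 < \<eta>" using e C by (simp add: \<eta>_def)
  have \<eta>C: "\<eta> * C \<le> \<epsilon> / 2" using e C by (simp add: \<eta>_def field_simps)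
  obtain d where d: "0 < d" and small: "\<And>h f. \<bar>h\<bar> \<le> d \<Longrightarrow> f \<in> sobolev s \<Longrightarrow> L2_norm (\<lambda>x. f (x + h) - f x) \<le> \<eta> * sobolev_norm s f"
    using sobolev_translation_small[OF s \<eta>] by blast
  have small': "L2_norm (\<lambda>x. g n (x + t) - g n x) \<le> \<epsilon> / 2" if "t \<in> {0..d}" for n t
  proof -
    have "L2_norm (\<lambda>x. g n (x + t) - g n x) \<le> \<eta> * sobolev_norm s (g n)" using that by (intro small g) auto
    also have "\<dots> \<le> \<eta> * C" using \<eta> bd by (intro mult_left_mono) auto
    finally show ?thesis using \<eta>C by simp
  qed
  have e2: "0 \<le> \<epsilon> / 2" using e by simp
  note avg = L2_norm_average_diff[OF gL2 d e2 small']
  have avL2: "average d (g n) \<in> L2" for n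
    using L2_add[OF avg(1)[of n] gL2[of n]] by simp
  \<comment> \<open>The bound C/sqrt d on the averages is a constant; it becomes a square integrable
    majorant only through the restriction to [-A, A].\<close>
  have "(\<lambda>n. L2_norm (\<lambda>x. cutoff A (average d (g n)) x - 0)) \<longlonglongrightarrow> 0"
  proof (rule L2_dominated_convergence[where w="\<lambda>x. C / sqrt d * indicator {-A..A} x"])
    show "integrable lborel (\<lambda>x. (C / sqrt d * indicator {-A..A} x)\<^sup>2)"
      unfolding power2_mult_indicator
      by (intro integrable_mult_right integrable_real_indicator) (auto simp: emeasure_lborel_Icc_eq)
    have "cmod (average d (g n) x) \<le> C / sqrt d" for n x
      using order_trans[OF average_bound[OF gL2 d] divide_right_mono[OF gC]] d by simp
    then show "AE x in lborel. cmod (cutoff A (average d (g n)) x - 0) \<le> C / sqrt d * indicator {-A..A} x" for n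
      by (auto simp: cutoff_def split: split_indicator)
    have "(\<lambda>n. cutoff A (average d (g n)) x) \<longlonglongrightarrow> 0" for x
      unfolding cutoff_def average_eq_inner
      by (intro tendsto_mult_right_zero tendsto_divide_zero weak indicator_Icc_L2)
    then show "AE x in lborel. (\<lambda>n. cutoff A (average d (g n)) x) \<longlonglongrightarrow> 0" by simp
  qed (use cutoff_L2(1)[OF avL2] in \<open>auto simp: L2_measurable\<close>)
  then have "eventually (\<lambda>n. L2_norm (cutoff A (average d (g n))) < \<epsilon> / 2) sequentially"
    using e by (intro order_tendstoD) auto
  then obtain N where N: "\<And>n. N \<le> n \<Longrightarrow> L2_norm (cutoff A (average d (g n))) < \<epsilon> / 2"
    unfolding eventually_sequentially by blast
  have "norm (L2_norm (cutoff A (g n)) - 0) < \<epsilon>" if "N \<le> n" for n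
  proof -
    have "L2_norm (cutoff A (g n)) = L2_norm (\<lambda>x. cutoff A (average d (g n)) x - cutoff A (\<lambda>x. average d (g n) x - g n x) x)"
      unfolding cutoff_diff by simp
    also have "\<dots> \<le> L2_norm (cutoff A (average d (g n))) + L2_norm (cutoff A (\<lambda>x. average d (g n) x - g n x))"
      by (intro L2_norm_diff_le cutoff_L2 avL2 avg)
    also have "L2_norm (cutoff A (\<lambda>x. average d (g n) x - g n x)) \<le> \<epsilon> / 2"
      by (rule order_trans[OF cutoff_L2(2)[OF avg(1)] avg(2)])
    finally show ?thesis using N[OF that] by simp
  qed
  then show "\<exists>N. \<forall>n\<ge>N. norm (L2_norm (cutoff A (g n)) - 0) < \<epsilon>" by blast
qed

section \<open>Remainders of the basis expansion\<close>

text \<open>An explicit representative of \<open>Q_proj e N f\<close> for orthonormal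
  \<open>e\<close>. It is linear in f at every point, as the uniform boundedness principle requires
  of its operators.\<close>

definition remainder :: "(nat \<Rightarrow> real \<Rightarrow> complex) \<Rightarrow> nat \<Rightarrow> (real \<Rightarrow> complex) \<Rightarrow> real \<Rightarrow> complex" where
  "remainder e N f = (\<lambda>t. f t - lin_comb N (\<lambda>n. L2_inner f (e n)) e t)"

lemma remainder_eq: "remainder e N f t = f t - (\<Sum>n<N. L2_inner f (e n) * e n t)"
  by (simp add: remainder_def lin_comb_def)

lemma lin_comb_L2: "(\<And>n. e n \<in> L2) \<Longrightarrow> lin_comb N a e \<in> L2"
  unfolding lin_comb_def by (intro L2_sum L2_scale)

lemma L2_inner_lin_comb_left:
  "(\<And>n. e n \<in> L2) \<Longrightarrow> h \<in> L2 \<Longrightarrow> L2_inner (lin_comb N a e) h = (\<Sum>n<N. a n * L2_inner (e n) h)"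
  unfolding lin_comb_def by (simp add: L2_inner_sum_left L2_scale L2_inner_scale_left)

lemma remainder_L2: "(\<And>n. e n \<in> L2) \<Longrightarrow> f \<in> L2 \<Longrightarrow> remainder e N f \<in> L2"
  unfolding remainder_def by (intro L2_diff lin_comb_L2)

lemma remainder_diff:
  assumes "\<And>n. e n \<in> L2" "f \<in> L2" "g \<in> L2"
  shows "remainder e N (\<lambda>t. f t - g t) = (\<lambda>t. remainder e N f t - remainder e N g t)"
  by (simp add: fun_eq_iff remainder_eq L2_inner_diff_left assms left_diff_distrib sum_subtractf)

lemma remainder_scale: "remainder e N (\<lambda>t. c * f t) = (\<lambda>t. c * remainder e N f t)"
  by (simp add: fun_eq_iff remainder_eq L2_inner_scale_left right_diff_distrib sum_distrib_left mult.assoc)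

locale L2_orthonormal =
  fixes e :: "nat \<Rightarrow> real \<Rightarrow> complex"
  assumes e_L2: "e n \<in> L2"
    and orthonormal: "L2_inner (e m) (e n) = (if m = n then 1 else 0)"
begin

lemma norm_e: "L2_norm (e n) = 1"
proof -
  have "complex_of_real ((L2_norm (e n))\<^sup>2) = 1"
    using L2_inner_self[of "e n"] orthonormal[of n n] by simp
  then have "(L2_norm (e n))\<^sup>2 = 1" by (simp only: of_real_eq_1_iff)
  then show ?thesis using power2_eq_1_iff[of "L2_norm (e n)"] L2_norm_nonneg[of "e n"] by linarith
qed

lemma inner_lin_comb_e: "i < N \<Longrightarrow> L2_inner (lin_comb N a e) (e i) = a i"
  by (simp add: L2_inner_lin_comb_left e_L2 orthonormal if_distrib cong: if_cong)

lemma inner_remainder_e: "f \<in> L2 \<Longrightarrow> i < N \<Longrightarrow> L2_inner (remainder e N f) (e i) = 0"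
  unfolding remainder_def by (simp add: L2_inner_diff_left lin_comb_L2 e_L2 inner_lin_comb_e)

lemma mem_orth_compl_span_first:
  assumes "g \<in> L2"
  shows "g \<in> L2_orth_compl (span_first N e) \<longleftrightarrow> (\<forall>i<N. L2_inner g (e i) = 0)"
proof
  assume g: "g \<in> L2_orth_compl (span_first N e)"
  show "\<forall>i<N. L2_inner g (e i) = 0"
  proof (intro allI impI)
    fix i assume "i < N"
    then have "lin_comb N (\<lambda>n. if n = i then 1 else 0) e = e i"
      by (simp add: lin_comb_def fun_eq_iff if_distrib[of "\<lambda>x. x * _"] cong: if_cong)
    then have "e i \<in> span_first N e" unfolding span_first_def by (metis (mono_tags, lifting) mem_Collect_eq)
    then show "L2_inner g (e i) = 0" using g by (simp add: L2_orth_compl_def)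
  qed
next
  assume o: "\<forall>i<N. L2_inner g (e i) = 0"
  have "L2_inner g (lin_comb N a e) = 0" for a
  proof -
    have "L2_inner (lin_comb N a e) g = (\<Sum>n<N. a n * cnj (L2_inner g (e n)))"
      unfolding L2_inner_lin_comb_left[OF e_L2 assms] by (simp add: L2_inner_commute[symmetric])
    also have "\<dots> = 0" using o by simp
    finally show ?thesis using L2_inner_commute[of g "lin_comb N a e"] by simp
  qed
  then show "g \<in> L2_orth_compl (span_first N e)"
    using assms by (auto simp: L2_orth_compl_def span_first_def)
qed

text \<open>The remainder is a valid witness for the choice in \<open>L2_orth_proj\<close>. Two
  witnesses differ by a function that lies in the complement and is orthogonal to it, hence has norm
  0.\<close>

lemma Q_proj_remainder:
  assumes f: "f \<in> L2"
  shows "Q_proj e N f \<in> L2" "L2_norm (\<lambda>t. Q_proj e N f t - remainder e N f t) = 0"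
proof -
  let ?K = "L2_orth_compl (span_first N e)"
  let ?r = "remainder e N f"
  have rL2: "?r \<in> L2" by (rule remainder_L2[OF e_L2 f])
  have rK: "?r \<in> ?K" using rL2 f by (simp add: mem_orth_compl_span_first inner_remainder_e)
  have fr: "(\<lambda>t. f t - ?r t) = lin_comb N (\<lambda>n. L2_inner f (e n)) e"
    by (simp add: remainder_def fun_eq_iff)
  have "L2_inner (lin_comb N a e) k = 0" if "k \<in> ?K" for a k
    using that L2_inner_commute[of "lin_comb N a e" k] by (auto simp: L2_orth_compl_def span_first_def)
  then have "(\<lambda>t. f t - ?r t) \<in> L2_orth_compl ?K"
    unfolding fr by (simp add: L2_orth_compl_def[of ?K] lin_comb_L2 e_L2)
  note r = rK this
  have q: "Q_proj e N f \<in> ?K \<and> (\<lambda>t. f t - Q_proj e N f t) \<in> L2_orth_compl ?K"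
    unfolding Q_proj_def L2_orth_proj_def by (rule someI[of _ ?r]) (use r in blast)
  then show qL2: "Q_proj e N f \<in> L2" by (simp add: L2_orth_compl_def)
  let ?d = "\<lambda>t. Q_proj e N f t - ?r t"
  have dL2: "?d \<in> L2" by (intro L2_diff qL2 rL2)
  have dK: "?d \<in> ?K"
    using q rK dL2 qL2 rL2 by (simp add: mem_orth_compl_span_first L2_inner_diff_left e_L2)
  have "L2_inner ?d ?d = L2_inner (\<lambda>t. (f t - ?r t) - (f t - Q_proj e N f t)) ?d" by simp
  also have "\<dots> = L2_inner (\<lambda>t. f t - ?r t) ?d - L2_inner (\<lambda>t. f t - Q_proj e N f t) ?d"
    by (intro L2_inner_diff_left L2_diff f rL2 qL2)
  also have "\<dots> = 0" using q r(2) dK by (simp add: L2_orth_compl_def[of ?K])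
  finally show "L2_norm ?d = 0" by (simp add: L2_inner_self)
qed

lemma L2_norm_cutoff_Q_proj:
  assumes f: "f \<in> L2"
  shows "L2_norm (cutoff A (Q_proj e N f)) = L2_norm (cutoff A (remainder e N f))"
proof -
  note Q = Q_proj_remainder[OF f, of N]
  have r: "remainder e N f \<in> L2" by (rule remainder_L2[OF e_L2 f])
  have "\<bar>L2_norm (cutoff A (Q_proj e N f)) - L2_norm (cutoff A (remainder e N f))\<bar>
      \<le> L2_norm (cutoff A (\<lambda>t. Q_proj e N f t - remainder e N f t))"
    unfolding cutoff_diff by (intro L2_norm_diff_ge cutoff_L2 Q r)
  also have "\<dots> \<le> L2_norm (\<lambda>t. Q_proj e N f t - remainder e N f t)"
    by (intro cutoff_L2 L2_diff Q r)
  finally show ?thesis using Q(2) by simp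
qed

text \<open>Approximate h by some k in the span of the first N elements. From n = N on, g n is
  orthogonal to k, and the error h - k contributes at most C times its norm.\<close>

lemma orthogonal_tail_weakly_null:
  assumes dense: "\<And>f \<delta>. f \<in> L2 \<Longrightarrow> 0 < \<delta> \<Longrightarrow> \<exists>N. \<exists>h\<in>span_first N e. L2_norm (\<lambda>t. f t - h t) < \<delta>"
    and g: "\<And>n. g n \<in> L2" and bd: "\<And>n. L2_norm (g n) \<le> C"
    and orth: "\<And>n i. i < n \<Longrightarrow> L2_inner (g n) (e i) = 0" and h: "h \<in> L2"
  shows "(\<lambda>n. L2_inner (g n) h) \<longlonglongrightarrow> 0"
proof (rule LIMSEQ_I)
  fix \<epsilon> :: real assume \<epsilon>: "0 < \<epsilon>"
  have C: "0 \<le> C" using order_trans[OF L2_norm_nonneg bd] .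
  obtain N k where k: "k \<in> span_first N e" "L2_norm (\<lambda>t. h t - k t) < \<epsilon> / (C + 1)"
    using dense[OF h, of "\<epsilon> / (C + 1)"] \<epsilon> C by auto
  have kL2: "k \<in> L2" using k(1) lin_comb_L2[OF e_L2] by (auto simp: span_first_def)
  have "norm (L2_inner (g n) h - 0) < \<epsilon>" if "N \<le> n" for n
  proof -
    have "g n \<in> L2_orth_compl (span_first N e)"
      using orth that by (simp add: mem_orth_compl_span_first g)
    then have "L2_inner (g n) k = 0" using k(1) by (simp add: L2_orth_compl_def)
    then have "L2_inner (g n) h = L2_inner (g n) (\<lambda>t. h t - k t)"
      using L2_inner_diff_right[OF h kL2 g] by simp
    then have "cmod (L2_inner (g n) h) \<le> L2_norm (g n) * L2_norm (\<lambda>t. h t - k t)"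
      using L2_inner_bound[OF g L2_diff[OF h kL2]] by simp
    also have "\<dots> \<le> C * (\<epsilon> / (C + 1))"
      using k(2) C by (intro mult_mono bd) auto
    also have "\<dots> < \<epsilon>" using \<epsilon> C by (simp add: field_simps)
    finally show ?thesis by simp
  qed
  then show "\<exists>N. \<forall>n\<ge>N. norm (L2_inner (g n) h - 0) < \<epsilon>" by blast
qed

end

section \<open>Bounds on the remainders in the Sobolev norm\<close>

locale L2_orthonormal_sobolev_basis = L2_orthonormal e for e +
  fixes s :: real
  assumes s: "0 < s"
    and e_sobolev: "e n \<in> sobolev s"
    and expansion: "f \<in> sobolev s \<Longrightarrow> \<exists>a. series_converges_to (sobolev_norm s) a e f"
begin

lemma lin_comb_sobolev: "lin_comb N a e \<in> sobolev s"
  unfolding lin_comb_def by (intro sobolev.sum_mem sobolev.scale_mem e_sobolev)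

lemma remainder_sobolev: "f \<in> sobolev s \<Longrightarrow> remainder e N f \<in> sobolev s"
  unfolding remainder_def by (intro sobolev.diff_mem lin_comb_sobolev)

lemma L2_norm_le: "f \<in> sobolev s \<Longrightarrow> L2_norm f \<le> sobolev_norm s f"
  using s by (intro L2_norm_le_sobolev_norm) auto

text \<open>
  Convergence in \<open>H\<^sup>s\<close> implies convergence in \<open>L\<^sup>2\<close>, so the coefficients of an \<open>H\<^sup>s\<close> expansion are
  the \<open>L\<^sup>2\<close> Fourier coefficients.
\<close>

lemma remainder_tendsto_0:
  assumes f: "f \<in> sobolev s"
  shows "(\<lambda>N. sobolev_norm s (remainder e N f)) \<longlonglongrightarrow> 0"
proof -
  obtain a where a: "(\<lambda>N. sobolev_norm s (\<lambda>t. f t - lin_comb N a e t)) \<longlonglongrightarrow> 0"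
    using expansion[OF f] by (auto simp: series_converges_to_def)
  have dL2: "(\<lambda>t. f t - lin_comb N a e t) \<in> sobolev s" for N
    by (intro sobolev.diff_mem f lin_comb_sobolev)
  have coeff: "L2_inner f (e i) = a i" for i
  proof -
    \<comment> \<open>For N > i the i-th coefficient of the partial sum is already a i, so this
      constant is bounded by the N-th error and must vanish.\<close>
    have "(\<lambda>N. L2_inner f (e i) - a i) \<longlonglongrightarrow> 0"
    proof (rule Lim_null_comparison[OF _ a], unfold eventually_sequentially, intro exI[of _ "Suc i"] allI impI)
      fix N assume N: "Suc i \<le> N"
      have "L2_inner f (e i) - a i = L2_inner (\<lambda>t. f t - lin_comb N a e t) (e i)"
        using N f by (simp add: L2_inner_diff_left sobolev_L2 lin_comb_L2 e_L2 inner_lin_comb_e)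
      also have "norm \<dots> \<le> L2_norm (\<lambda>t. f t - lin_comb N a e t) * 1"
        using L2_inner_bound[OF sobolev_L2[OF dL2] e_L2] by (simp add: norm_e)
      also have "\<dots> \<le> sobolev_norm s (\<lambda>t. f t - lin_comb N a e t)"
        using L2_norm_le[OF dL2] by simp
      finally show "norm (L2_inner f (e i) - a i) \<le> sobolev_norm s (\<lambda>t. f t - lin_comb N a e t)" .
    qed
    then show ?thesis by (simp add: LIMSEQ_const_iff)
  qed
  show ?thesis using a unfolding remainder_def coeff .
qed

text \<open>Continuity of each single remainder operator, with a bound that may grow with N: one of
  the inputs of the uniform boundedness principle.\<close>

lemma remainder_bounded: "\<exists>B. \<forall>f\<in>sobolev s. sobolev_norm s (remainder e N f) \<le> B * sobolev_norm s f"
proof (intro exI ballI)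
  fix f assume f: "f \<in> sobolev s"
  have coeff: "cmod (L2_inner f (e n)) \<le> sobolev_norm s f" for n
    using L2_inner_bound[OF sobolev_L2[OF f] e_L2, of n] L2_norm_le[OF f] by (simp add: norm_e)
  let ?l = "lin_comb N (\<lambda>n. L2_inner f (e n)) e"
  have "sobolev_norm s (remainder e N f) \<le> sobolev_norm s f + sobolev_norm s (\<lambda>t. -1 * ?l t)"
    unfolding remainder_def using sobolev.triangle[OF f sobolev.scale_mem[OF lin_comb_sobolev], of "-1"] by simp
  also have "sobolev_norm s (\<lambda>t. -1 * ?l t) = sobolev_norm s ?l"
    using sobolev.scale[OF lin_comb_sobolev, of "-1"] by simp
  also have "sobolev_norm s ?l \<le> (\<Sum>n<N. sobolev_norm s (\<lambda>t. L2_inner f (e n) * e n t))"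
    unfolding lin_comb_def by (intro sobolev.sum_le sobolev.scale_mem e_sobolev)
  also have "\<dots> \<le> (\<Sum>n<N. sobolev_norm s f * sobolev_norm s (e n))"
    unfolding sobolev.scale[OF e_sobolev]
    by (intro sum_mono mult_right_mono coeff sobolev.nonneg e_sobolev)
  finally show "sobolev_norm s (remainder e N f) \<le> (1 + (\<Sum>n<N. sobolev_norm s (e n))) * sobolev_norm s f"
    by (simp add: sum_distrib_left[symmetric] algebra_simps)
qed

lemma remainder_uniformly_bounded:
  obtains C where "0 \<le> C" "\<And>N f. f \<in> sobolev s \<Longrightarrow> sobolev_norm s (remainder e N f) \<le> C * sobolev_norm s f"
proof -
  have "\<exists>C. \<forall>N. \<forall>f\<in>sobolev s. sobolev_norm s (remainder e N f) \<le> C * sobolev_norm s f"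
  proof (rule sobolev.uniform_boundedness)
    show "\<exists>u\<in>sobolev s. (\<lambda>n. sobolev_norm s (\<lambda>x. f n x - u x)) \<longlonglongrightarrow> 0"
      if "\<And>n. f n \<in> sobolev s" "\<And>n. sobolev_norm s (\<lambda>x. f (Suc n) x - f n x) \<le> c * (1/4) ^ n" for f c
      using sobolev_complete[OF less_imp_le[OF s] that] .
    show "\<exists>M. \<forall>n. sobolev_norm s (remainder e n f) \<le> M" if f: "f \<in> sobolev s" for f
    proof -
      obtain M where "\<And>n. norm (sobolev_norm s (remainder e n f)) \<le> M"
        using convergent_imp_Bseq[OF convergentI[OF remainder_tendsto_0[OF f]]] by (auto simp: Bseq_def)
      then show ?thesis by (metis abs_ge_self order_trans real_norm_def)
    qed
  qed (auto simp: remainder_sobolev remainder_diff e_L2 sobolev_L2 remainder_scale remainder_bounded)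
  then obtain C where C: "\<And>N f. f \<in> sobolev s \<Longrightarrow> sobolev_norm s (remainder e N f) \<le> C * sobolev_norm s f"
    by blast
  have "sobolev_norm s (remainder e N f) \<le> \<bar>C\<bar> * sobolev_norm s f" if "f \<in> sobolev s" for N f
    using order_trans[OF C[OF that] mult_right_mono[OF abs_ge_self sobolev.nonneg[OF that]]] .
  then show ?thesis using that[of "\<bar>C\<bar>"] by simp
qed

end

theorem lemma4p2:
  fixes s :: real and e :: "nat \<Rightarrow> real \<Rightarrow> complex"
  assumes "s > 0"
    and "L2_orthonormal_basis e"
    and "unconditional_basis (sobolev s) (sobolev_norm s) e"
  shows "\<forall>A>0. \<forall>\<epsilon>>0. \<exists>N\<ge>1. \<forall>f\<in>sobolev s.
           L2_norm (cutoff A (Q_proj e N f)) \<le> \<epsilon> * sobolev_norm s f"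
proof (intro allI impI, rule ccontr)
  fix A \<epsilon> :: real assume \<epsilon>: "0 < \<epsilon>"
  assume "\<not> (\<exists>N\<ge>1. \<forall>f\<in>sobolev s. L2_norm (cutoff A (Q_proj e N f)) \<le> \<epsilon> * sobolev_norm s f)"
  \<comment> \<open>\<open>Suc n\<close> runs through all N at least 1.\<close>
  then have "\<forall>n. \<exists>f\<in>sobolev s. \<epsilon> * sobolev_norm s f < L2_norm (cutoff A (Q_proj e (Suc n) f))"
    by (metis One_nat_def Suc_le_mono le0 not_less)
  then obtain f where f: "\<And>n. f n \<in> sobolev s"
    and large: "\<And>n. \<epsilon> * sobolev_norm s (f n) < L2_norm (cutoff A (Q_proj e (Suc n) (f n)))"
    by metis
  interpret L2_orthonormal_sobolev_basis e s
    using assms by unfold_locales (auto simp: L2_orthonormal_basis_def unconditional_basis_def)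
  obtain C where C: "0 \<le> C"
    "\<And>N f. f \<in> sobolev s \<Longrightarrow> sobolev_norm s (remainder e N f) \<le> C * sobolev_norm s f"
    using remainder_uniformly_bounded by blast
  have rL2: "remainder e (Suc n) (f n) \<in> L2" for n
    by (rule sobolev_L2[OF remainder_sobolev[OF f]])
  have large': "\<epsilon> * sobolev_norm s (f n) < L2_norm (cutoff A (remainder e (Suc n) (f n)))" for n
    using large[of n] by (simp add: L2_norm_cutoff_Q_proj sobolev_L2[OF f])
  \<comment> \<open>Needed for the normalisation. If the norm were 0, the H^s bound would make the
    remainder null as well, against the strict inequality in \<open>large'\<close>.\<close>
  have pos: "0 < sobolev_norm s (f n)" for n
  proof (rule ccontr)
    assume "\<not> ?thesis"
    then have "sobolev_norm s (f n) = 0" using sobolev.nonneg[OF f, of n] by simp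
    then show False
      using large'[of n] cutoff_L2(2)[OF rL2, of A n] L2_norm_le[OF remainder_sobolev[OF f], of "Suc n" n] C(2)[OF f, of "Suc n" n]
      by simp
  qed
  define c where "c n = complex_of_real (1 / sobolev_norm s (f n))" for n
  have norm_c: "cmod (c n) = 1 / sobolev_norm s (f n)" for n
    using pos[of n] by (simp add: c_def norm_divide)
  \<comment> \<open>Dividing by the norm of f n, not of the remainder, keeps the lower bound
    \<epsilon> on [-A, A]; the H^s bound C then comes from uniform boundedness.\<close>
  define g where "g n = (\<lambda>t. c n * remainder e (Suc n) (f n) t)" for n
  have g: "g n \<in> sobolev s" for n
    unfolding g_def by (intro sobolev.scale_mem remainder_sobolev f)
  have gC: "sobolev_norm s (g n) \<le> C" for n
    using C(2)[OF f, of "Suc n" n] pos[of n]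
    unfolding g_def sobolev.scale[OF remainder_sobolev[OF f]] norm_c by (simp add: field_simps)
  have "(\<lambda>n. L2_norm (cutoff A (g n))) \<longlonglongrightarrow> 0"
  proof (rule weakly_null_cutoff_tendsto_0[OF assms(1) g gC orthogonal_tail_weakly_null])
    show "L2_norm (g n) \<le> C" for n by (rule order_trans[OF L2_norm_le[OF g] gC])
    show "L2_inner (g n) (e i) = 0" if "i < n" for n i
      using that unfolding g_def L2_inner_scale_left by (simp add: inner_remainder_e sobolev_L2[OF f])
    show "\<exists>N. \<exists>h\<in>span_first N e. L2_norm (\<lambda>t. f t - h t) < \<delta>" if "f \<in> L2" "0 < \<delta>" for f \<delta>
      using assms(2) that by (simp add: L2_orthonormal_basis_def)
  qed (use sobolev_L2[OF g] in auto)
  moreover have "\<epsilon> \<le> L2_norm (cutoff A (g n))" for n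
    using large'[of n] pos[of n]
    unfolding g_def cutoff_scale L2_norm_scale norm_c by (simp add: field_simps)
  ultimately have "\<epsilon> \<le> 0" by (intro LIMSEQ_le_const) auto
  then show False using \<epsilon> by simp
qed

end
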